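(* Let $\{a_i\}_{i\ge1}$ be free, identically distributed self-adjoint variables in $(\mathcal{A},\varphi)$ with $\alpha=\varphi(a_1)\neq0$, and let $N_n$, $n\ge1$, be non-negative integer-valued random variables with all moments finite, independent of $\{a_i\}$. Suppose that as $n\to\infty$, $\eta_n\to\infty$, $\sigma_n^2\to\infty$, $\mathbb{E}[|N_n-\eta_n|^m]=O(\sigma_n^m)$ for all $m\in\mathbb{N}$, and $\gamma_n^2=o(\eta_n)$. Then $\tilde{\mathcal{S}}_{N_n}\stackrel{*}{\to}s$, where $s$ is a standard semi-circle variable. If $\tilde{\mathcal{S}}_{N_n}$ have probability measures $\mu_n$, then they converge weakly to the probability measure $\mu_s$ of $s$.
   Context: $(\mathcal{A},\varphi)$ is a non-commutative probability space (NCP), that is, a unital algebra $\mathcal{A}$ with unit $1_{\mathcal{A}}$ (carrying an involution $*$, so that self-adjoint means $a=a^*$) and a linear functional $\varphi:\mathcal{A}\to\mathbb{C}$ with $\varphi(1_{\mathcal{A}})=1$; it may be a $*$-probability space (the case where $\varphi$ is positive, $\varphi(aa^* )\ge0$), but this is not required. "Free" means freely independent: $\varphi(p_1(a_{i_1})\cdots p_k(a_{i_k}))=0$ whenever the $p_j$ are polynomials with $\varphi(p_j(a_{i_j}))=0$ for all $j$ and consecutive indices $i_j,i_{j+1}$ are distinct. "Identically distributed" means $\varphi(a_i^m)=\varphi(a_1^m)$ for all $i,m$. Notation: $\theta^2=\varphi(a_1^2)-\alpha^2$; $\eta_n=\mathbb{E}[N_n]$, $\gamma_n^2=\mathbb{V}\mathrm{ar}(N_n)$,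 $\sigma_n^2=\eta_n\theta^2+\gamma_n^2\alpha^2$. $\mathcal{S}_k=a_1+\cdots+a_k$, $\mathcal{S}_0=0$, $\mathcal{S}_{N_n}=a_1+\cdots+a_{N_n}$, and $\tilde{\mathcal{S}}_{N_n}=(\mathcal{S}_{N_n}-\eta_n\alpha)/\sigma_n$. The random sums live in a larger non-commutative probability space with state $\tilde\varphi=\mathbb{E}\varphi$, in which $N_n$ is independent of $\mathcal{A}$: for a polynomial $P$, $\tilde\varphi(P(\mathcal{S}_{N_n}))=\sum_{i\ge0}\mathbb{P}\{N_n=i\}\varphi(P(\mathcal{S}_i))$. For self-adjoint variables, $x_n\stackrel{*}{\to}x$ means that every moment of $x_n$ (computed in its state) converges to the corresponding moment of $x$. The probability measure of a self-adjoint variable is the unique probability measure on $\mathbb{R}$ having the same moments, if such exists. A standard semi-circle variable is a self-adjoint variable whose probability measure has density $\frac{1}{2\pi}\sqrt{4-x^2}$ on $[-2,2]$.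
   Formalization: The formal theorem additionally assumes θ² = φ(a₁²) − α² ≠ 0; without it the claim fails, e.g. a_i = 1 and N_n = n⁴ ± n with probability 1/2 each, where the normalized sum is ±1 with fourth moment 1 instead of 2. *)

theory Defs
  imports
    "HOL-Probability.Probability"
    "HOL-Library.Function_Algebras"
    "HOL-Library.Landau_Symbols"
begin

text \<open>
  HOL-Analysis has no type class of complex algebras, so the complex scalar multiplication is a
  locale parameter.
\<close>

locale complex_star_algebra = vector_space smul
  for smul :: "complex \<Rightarrow> 'a::ring_1 \<Rightarrow> 'a" +
  fixes star :: "'a \<Rightarrow> 'a"
  assumes smul_mult_left: "smul c x * y = smul c (x * y)"
    and smul_mult_right: "x * smul c y = smul c (x * y)"
    and star_add: "star (x + y) = star x + star y"
    and star_smul: "star (smul c x) = smul (cnj c) (star x)"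
    and star_mult: "star (x * y) = star y * star x"
    and star_star: "star (star x) = x"

text \<open>No positivity and no compatibility of the functional with the involution is required.\<close>

locale nc_prob_space = complex_star_algebra smul star
  for smul :: "complex \<Rightarrow> 'a::ring_1 \<Rightarrow> 'a" and star :: "'a \<Rightarrow> 'a" +
  fixes \<phi> :: "'a \<Rightarrow> complex"
  assumes linear_functional: "Vector_Spaces.linear smul (*) \<phi>"
    and unital: "\<phi> 1 = 1"

definition alg_poly ::
    "(complex \<Rightarrow> 'a::ring_1 \<Rightarrow> 'a) \<Rightarrow> complex poly \<Rightarrow> 'a \<Rightarrow> 'a" where
  "alg_poly smul p x = (\<Sum>d\<le>degree p. smul (coeff p d) (x ^ d))"

text \<open>
  The product is the ordered one, with factors numbered \<open>0, \<dots>, k - 1\<close>. The case \<open>k = 0\<close> has to be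
  excluded, since the empty product is the unit.
\<close>

definition freely_independent ::
    "(complex \<Rightarrow> 'a::ring_1 \<Rightarrow> 'a) \<Rightarrow> ('a \<Rightarrow> complex) \<Rightarrow> 'i set \<Rightarrow> ('i \<Rightarrow> 'a) \<Rightarrow> bool" where
  "freely_independent smul \<phi> I a \<longleftrightarrow>
    (\<forall>k\<ge>1. \<forall>i p.
      (\<forall>j<k. i j \<in> I \<and> \<phi> (alg_poly smul (p j) (a (i j))) = 0) \<longrightarrow>
      (\<forall>j. Suc j < k \<longrightarrow> i j \<noteq> i (Suc j)) \<longrightarrow>
      \<phi> (prod_list (map (\<lambda>j. alg_poly smul (p j) (a (i j))) [0..<k])) = 0)"

text \<open>
  The algebra in which the random sums live consists of the \<open>'a\<close>-valued functions on the classical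
  sample space, with pointwise operations; elements of \<open>'a\<close> are the constant functions and are thus
  independent of all classical random variables. Its state is \<open>\<phi>\<close> followed by the expectation.
\<close>

definition expected_state :: "'w measure \<Rightarrow> ('a \<Rightarrow> complex) \<Rightarrow> ('w \<Rightarrow> 'a) \<Rightarrow> complex" where
  "expected_state M \<phi> X = (\<integral>\<omega>. \<phi> (X \<omega>) \<partial>M)"

lemma expected_state_eq_suminf:
  fixes N :: "'w \<Rightarrow> nat"
  assumes "prob_space M" "N \<in> measurable M (count_space UNIV)"
    and "integrable M (\<lambda>\<omega>. \<phi> (F (N \<omega>)))"
  shows "expected_state M \<phi> (\<lambda>\<omega>. F (N \<omega>)) =
    (\<Sum>i. of_real (measure M {\<omega> \<in> space M. N \<omega> = i}) * \<phi> (F i))"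
proof -
  interpret prob_space M by fact
  define A where "A i = {\<omega> \<in> space M. N \<omega> = i}" for i
  have A: "A i \<in> sets M" for i
    using assms(2) unfolding A_def by measurable
  have U: "(\<Union>i. A i) = space M" by (auto simp: A_def)
  have summand: "(LINT \<omega>:A i|M. \<phi> (F (N \<omega>))) = of_real (measure M (A i)) * \<phi> (F i)" for i
  proof -
    have "(LINT \<omega>:A i|M. \<phi> (F (N \<omega>))) = (LINT \<omega>:A i|M. \<phi> (F i))"
      by (rule set_lebesgue_integral_cong) (auto simp: A, auto simp: A_def)
    also have "\<dots> = of_real (measure M (A i)) * \<phi> (F i)"
      unfolding set_lebesgue_integral_def using A by (simp add: scaleR_conv_of_real)
    finally show ?thesis .
  qed
  have "expected_state M \<phi> (\<lambda>\<omega>. F (N \<omega>)) = (LINT \<omega>:(\<Union>i. A i)|M. \<phi> (F (N \<omega>)))"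
    unfolding expected_state_def U by (simp add: set_integral_space assms(3))
  also have "\<dots> = (\<Sum>i. LINT \<omega>:A i|M. \<phi> (F (N \<omega>)))"
    by (rule lebesgue_integral_countable_add)
      (use A assms(3) in \<open>auto simp: U set_integral_space set_integrable_def A_def
         intro!: integrable_mult_indicator\<close>)
  finally show ?thesis by (simp only: summand) (simp add: A_def)
qed

definition partial_sum :: "(nat \<Rightarrow> 'a::ring_1) \<Rightarrow> nat \<Rightarrow> 'a" where
  "partial_sum a k = (\<Sum>i=1..k. a i)"

text \<open>\<open>x n \<rightarrow> y\<close> in moments, each \<open>x n\<close> being taken with its own state \<open>\<Phi> n\<close>.\<close>

definition converges_star ::
    "(nat \<Rightarrow> 'b::monoid_mult \<Rightarrow> complex) \<Rightarrow> (nat \<Rightarrow> 'b) \<Rightarrow>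
     ('c::monoid_mult \<Rightarrow> complex) \<Rightarrow> 'c \<Rightarrow> bool" where
  "converges_star \<Phi> x \<psi> y \<longleftrightarrow> (\<forall>m. (\<lambda>n. \<Phi> n (x n ^ m)) \<longlonglongrightarrow> \<psi> (y ^ m))"

definition same_moments ::
    "('b::monoid_mult \<Rightarrow> complex) \<Rightarrow> 'b \<Rightarrow> real measure \<Rightarrow> bool" where
  "same_moments \<psi> x \<mu> \<longleftrightarrow>
    (\<forall>m. integrable \<mu> (\<lambda>t. t ^ m) \<and> complex_of_real (\<integral>t. t ^ m \<partial>\<mu>) = \<psi> (x ^ m))"

definition is_probability_measure_of ::
    "('b::monoid_mult \<Rightarrow> complex) \<Rightarrow> 'b \<Rightarrow> real measure \<Rightarrow> bool" where
  "is_probability_measure_of \<psi> x \<mu> \<longleftrightarrow>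
    real_distribution \<mu> \<and> same_moments \<psi> x \<mu> \<and>
    (\<forall>\<nu>. real_distribution \<nu> \<and> same_moments \<psi> x \<nu> \<longrightarrow> \<nu> = \<mu>)"

definition semicircle_density :: "real \<Rightarrow> real" where
  "semicircle_density t = (if t \<in> {-2..2} then sqrt (4 - t\<^sup>2) / (2 * pi) else 0)"

definition standard_semicircle_variable ::
    "('a::ring_1 \<Rightarrow> 'a) \<Rightarrow> ('a \<Rightarrow> complex) \<Rightarrow> 'a \<Rightarrow> bool" where
  "standard_semicircle_variable star \<psi> s \<longleftrightarrow>
    star s = s \<and> is_probability_measure_of \<psi> s (density lborel (\<lambda>t. ennreal (semicircle_density t)))"

end

theory Submission
  imports Defs
begin

text \<open>
  Write \<open>b i = a i - \<alpha>\<close> and \<open>T = b 1 + \<dots> + b k\<close>. Freeness makes the moments of words in the \<open>b i\<close>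
  exchangeable, zero if some letter occurs only once, and multiplicative along a pair \<open>b i \<dots> b i\<close>
  of letters that occur nowhere else. Sorting the words of \<open>T ^ (n + 2)\<close> by the multiplicity of
  their first letter therefore gives
  \<open>\<phi> (T ^ (n + 2)) = k * \<theta>\<^sup>2 * (\<Sum>p\<le>n. \<phi> (T ^ p) * \<phi> (T ^ (n - p))) + lower order\<close>, where the remaining words
  use too few distinct letters to matter. This is the Catalan recursion, so \<open>\<phi> (T ^ n)\<close> is asymptotic
  to \<open>(\<theta> * sqrt k) ^ n\<close> times the \<open>n\<close>-th semicircle moment. With \<open>k\<close> replaced by the random
  \<open>N n\<close>, the shift \<open>\<alpha> * (N n - \<eta> n)\<close> and the fluctuation of \<open>sqrt (N n)\<close> cost one factor
  \<open>\<bar>N n - \<eta> n\<bar>\<close>, whose second moment \<open>\<gamma>\<^sup>2\<close> is \<open>o(\<eta>)\<close>; by Cauchy-Schwarz both disappear after the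
  normalization. Weak convergence follows from that of the moments by Levy's continuity theorem.
\<close>

section \<open>Words in free variables\<close>

context complex_star_algebra
begin

section \<open>Polynomials evaluated at an element of the algebra\<close>

lemma alg_poly_altdef:
  assumes "degree p \<le> n"
  shows "alg_poly smul p x = (\<Sum>d\<le>n. smul (coeff p d) (x ^ d))"
  unfolding alg_poly_def
  by (rule sum.mono_neutral_left) (use assms in \<open>auto simp: coeff_eq_0\<close>)

lemma alg_poly_add: "alg_poly smul (p + q) x = alg_poly smul p x + alg_poly smul q x"
proof -
  let ?n = "max (degree p) (degree q)"
  have "degree (p + q) \<le> ?n" by (rule degree_add_le_max)
  then show ?thesis
    by (simp add: alg_poly_altdef[of _ ?n] scale_left_distrib sum.distrib)
qed

lemma alg_poly_smult: "alg_poly smul (smult c p) x = smul c (alg_poly smul p x)"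
  by (simp add: alg_poly_altdef[of _ "degree p"] degree_smult_le scale_sum_right)

lemma alg_poly_pCons: "alg_poly smul (pCons c p) x = smul c 1 + x * alg_poly smul p x"
proof -
  have "alg_poly smul (pCons c p) x
      = (\<Sum>d\<le>Suc (degree p). smul (coeff (pCons c p) d) (x ^ d))"
    by (rule alg_poly_altdef) (rule degree_pCons_le)
  also have "\<dots> = smul c 1 + x * alg_poly smul p x"
    by (simp only: sum.atMost_Suc_shift)
      (simp add: alg_poly_def sum_distrib_left smul_mult_right)
  finally show ?thesis .
qed

lemma alg_poly_0 [simp]: "alg_poly smul 0 x = 0"
  by (simp add: alg_poly_def)

text \<open>Products of polynomials arise only by multiplying with the linear
  \<open>centering\<close>, so a linear left factor is enough.\<close>

lemma alg_poly_linear_mult: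
  "alg_poly smul ([:c, 1:] * p) x = alg_poly smul [:c, 1:] x * alg_poly smul p x"
  by (simp add: alg_poly_add alg_poly_smult alg_poly_pCons distrib_right distrib_left
      smul_mult_left smul_mult_right)

end

locale free_identical = nc_prob_space smul star \<phi>
  for smul :: "complex \<Rightarrow> 'a::ring_1 \<Rightarrow> 'a" and star :: "'a \<Rightarrow> 'a" and \<phi> :: "'a \<Rightarrow> complex" +
  fixes a :: "nat \<Rightarrow> 'a"
  assumes free: "freely_independent smul \<phi> {1..} a"
    and identically_distributed: "i \<ge> 1 \<Longrightarrow> \<phi> (a i ^ m) = \<phi> (a 1 ^ m)"
begin

lemma \<phi>_add: "\<phi> (x + y) = \<phi> x + \<phi> y"
  using linear_functional by (simp add: Vector_Spaces.linear_iff)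

lemma \<phi>_smul: "\<phi> (smul c x) = c * \<phi> x"
  using linear_functional by (simp add: Vector_Spaces.linear_iff)

lemma \<phi>_0 [simp]: "\<phi> 0 = 0"
  using \<phi>_smul[of 0 0] by simp

lemma \<phi>_sum: "\<phi> (\<Sum>x\<in>A. F x) = (\<Sum>x\<in>A. \<phi> (F x))"
  by (induction A rule: infinite_finite_induct) (auto simp: \<phi>_add)

abbreviation ev :: "complex poly \<Rightarrow> 'a \<Rightarrow> 'a" where "ev \<equiv> alg_poly smul"

definition mean :: "complex poly \<Rightarrow> complex" where "mean p = \<phi> (ev p (a 1))"

lemma \<phi>_ev: "i \<ge> 1 \<Longrightarrow> \<phi> (ev p (a i)) = mean p"
  unfolding mean_def alg_poly_def \<phi>_sum \<phi>_smul
  by (metis identically_distributed)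

lemma mean_add: "mean (p + q) = mean p + mean q"
  by (simp add: mean_def alg_poly_add \<phi>_add)

lemma mean_const: "mean [:c:] = c"
  by (simp add: mean_def alg_poly_pCons \<phi>_smul unital)

lemma mean_minus_const: "mean (p - [:mean p:]) = 0"
  using mean_add[of "p - [:mean p:]" "[:mean p:]"] by (simp add: mean_const)

definition \<alpha> :: complex where "\<alpha> = \<phi> (a 1)"

definition centering :: "complex poly" where "centering = [:-\<alpha>, 1:]"

definition b :: "nat \<Rightarrow> 'a" where "b i = a i - smul \<alpha> 1"

lemma ev_centering: "ev centering (a i) = b i"
  by (simp add: centering_def b_def alg_poly_pCons)

lemma mean_centering: "mean centering = 0"
  unfolding mean_def ev_centering b_def
  using \<phi>_add[of "a 1 - smul \<alpha> 1" "smul \<alpha> 1"] by (simp add: \<phi>_smul unital \<alpha>_def)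

text \<open>
  A word is a list of (index, polynomial) pairs. Its evaluation depends on a relabelling \<open>g\<close> of the
  indices: carrying \<open>g\<close> along is what makes the exchangeability of the family visible.
\<close>

definition evaluation :: "(nat \<times> complex poly) list \<Rightarrow> (nat \<Rightarrow> nat) \<Rightarrow> 'a" where
  "evaluation ws g = prod_list (map (\<lambda>(i, p). ev p (a (g i))) ws)"

lemma evaluation_Nil [simp]: "evaluation [] g = 1"
  and evaluation_Cons: "evaluation ((i, p) # ws) g = ev p (a (g i)) * evaluation ws g"
  and evaluation_append: "evaluation (ws @ ws') g = evaluation ws g * evaluation ws' g"
  by (auto simp: evaluation_def)

text \<open>Alternation is imposed on the labels before relabelling, so that membership does not
  depend on \<open>g\<close>; an injective \<open>g\<close> carries it over to the actual
  indices.\<close>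

definition reduced :: "nat set \<Rightarrow> (nat \<times> complex poly) list set" where
  "reduced J = {ws. distinct_adj (map fst ws) \<and> fst ` set ws \<subseteq> J \<and> (\<forall>w\<in>set ws. mean (snd w) = 0)}"

lemma reduced_Nil [simp]: "[] \<in> reduced J"
  by (simp add: reduced_def)

lemma reduced_Cons:
  "(i, p) # ws \<in> reduced J \<longleftrightarrow>
    i \<in> J \<and> mean p = 0 \<and> ws \<in> reduced J \<and> (ws \<noteq> [] \<longrightarrow> i \<noteq> fst (hd ws))"
  by (cases ws) (auto simp: reduced_def)

lemma reduced_mono: "J \<subseteq> J' \<Longrightarrow> reduced J \<subseteq> reduced J'"
  by (auto simp: reduced_def)

text \<open>A label outside \<open>J\<close> differs from both of its neighbours, hence inserting it
  cannot destroy alternation.\<close>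

lemma reduced_append_Cons:
  assumes "us \<in> reduced J" "ws \<in> reduced J" "i \<notin> J" "mean p = 0"
  shows "us @ (i, p) # ws \<in> reduced (insert i J)"
  using assms(1)
proof (induction us)
  case Nil
  have "ws \<noteq> [] \<Longrightarrow> fst (hd ws) \<in> J"
    using assms(2) by (cases ws) (auto simp: reduced_def)
  with assms show ?case
    using reduced_mono[of J "insert i J"] by (auto simp: reduced_Cons)
next
  case (Cons u us)
  then show ?case using assms(3)
    by (cases u; cases us) (auto simp: reduced_Cons)
qed

text \<open>This is freeness in list form: injectivity of \<open>g\<close> on \<open>J\<close> keeps
  neighbouring indices distinct, and identical distribution makes a letter with \<open>mean\<close>
  zero centered at every index.\<close>

lemma \<phi>_evaluation_reduced:
  assumes ws: "ws \<in> reduced J" "ws \<noteq> []" and g: "inj_on g J" "g ` J \<subseteq> {1..}"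
  shows "\<phi> (evaluation ws g) = 0"
proof -
  define i where "i j = g (fst (ws ! j))" for j
  define p where "p j = snd (ws ! j)" for j
  have in_J: "fst (ws ! j) \<in> J" if "j < length ws" for j
    using ws that by (force simp: reduced_def)
  have "\<phi> (prod_list (map (\<lambda>j. ev (p j) (a (i j))) [0..<length ws])) = 0"
  proof (rule free[unfolded freely_independent_def, rule_format])
    show "1 \<le> length ws" using ws by (cases ws) auto
  next
    fix j assume j: "j < length ws"
    have i1: "i j \<in> {1..}" using in_J[OF j] g by (auto simp: i_def)
    moreover have "mean (p j) = 0" using ws j by (auto simp: reduced_def p_def)
    ultimately show "i j \<in> {1..} \<and> \<phi> (ev (p j) (a (i j))) = 0" by (simp add: \<phi>_ev)
  next
    fix j assume j: "Suc j < length ws"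
    have "fst (ws ! j) \<noteq> fst (ws ! Suc j)"
      using ws j by (auto simp: reduced_def distinct_adj_conv_nth)
    with in_J[of j] in_J[of "Suc j"] j g show "i j \<noteq> i (Suc j)"
      by (auto simp: i_def inj_on_def)
  qed
  also have "map (\<lambda>j. ev (p j) (a (i j))) [0..<length ws] = map (\<lambda>(i, p). ev p (a (g i))) ws"
    by (rule nth_equalityI) (auto simp: i_def p_def split: prod.splits)
  finally show ?thesis by (simp add: evaluation_def)
qed

text \<open>The span is taken among functions of \<open>g\<close>, not among elements of the
  algebra: the coefficients are then the same for all relabellings, which is the source of
  exchangeability.\<close>

inductive lin :: "(nat \<times> complex poly) list set \<Rightarrow> ((nat \<Rightarrow> nat) \<Rightarrow> 'a) \<Rightarrow> bool" for W where
  zero: "lin W (\<lambda>g. 0)"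
| word: "ws \<in> W \<Longrightarrow> lin W (evaluation ws)"
| add: "lin W F \<Longrightarrow> lin W G \<Longrightarrow> lin W (\<lambda>g. F g + G g)"
| smul: "lin W F \<Longrightarrow> lin W (\<lambda>g. smul c (F g))"

text \<open>Bilinearity leaves only products of two words. Such a product need not be a word of
  \<open>X\<close> itself, since equal labels at the junction have to be merged and
  recentered.\<close>

lemma lin_mult:
  assumes "lin V F" "lin W G" "\<And>vs ws. vs \<in> V \<Longrightarrow> ws \<in> W \<Longrightarrow> lin X (\<lambda>g. evaluation vs g * evaluation ws g)"
  shows "lin X (\<lambda>g. F g * G g)"
  using assms(1)
proof induction
  case zero
  show ?case using lin.zero by simp
next
  case (word vs)
  from assms(2) show ?case
  proof induction
    case zero
    show ?case using lin.zero by simp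
  qed (auto simp: distrib_left smul_mult_right intro: lin.intros assms(3) word)
qed (auto simp: distrib_right smul_mult_left intro: lin.intros)

lemma lin_mult_append:
  assumes "lin V F" "lin W G" "\<And>vs ws. vs \<in> V \<Longrightarrow> ws \<in> W \<Longrightarrow> vs @ ws \<in> X"
  shows "lin X (\<lambda>g. F g * G g)"
  by (rule lin_mult[OF assms(1,2)]) (simp add: evaluation_append[symmetric] lin.word assms(3))

lemma lin_letter: "lin {[(i, p)]} (\<lambda>g. ev p (a (g i)))"
  using lin.word[of "[(i, p)]" "{[(i, p)]}"] by (simp add: evaluation_def[abs_def])

text \<open>The new letter either has another label than the first one, and the word stays reduced,
  or it merges with it; the merged polynomial is split into its centered part and its mean, a scalar
  independent of \<open>g\<close>.\<close>

lemma lin_b: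
  assumes "i \<in> J" and F: "lin (reduced J) F"
  shows "lin (reduced J) (\<lambda>g. b (g i) * F g)"
proof -
  have "lin (reduced J) (\<lambda>g. ev centering (a (g i)) * F g)"
  proof (rule lin_mult[OF lin_letter F])
    fix vs ws assume vs: "vs \<in> {[(i, centering)]}" and ws: "ws \<in> reduced J"
    show "lin (reduced J) (\<lambda>g. evaluation vs g * evaluation ws g)"
    proof (cases "ws \<noteq> [] \<and> fst (hd ws) = i")
      case False
      then have "vs @ ws \<in> reduced J"
        using vs ws assms(1) by (auto simp: reduced_Cons mean_centering)
      then show ?thesis by (simp add: evaluation_append[symmetric] lin.word)
    next
      case True
      then obtain q ws' where ws_eq: "ws = (i, q) # ws'" by (cases ws) auto
      define r where "r = centering * q"
      have ws': "ws' \<in> reduced J" and r: "(i, r - [:mean r:]) # ws' \<in> reduced J"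
        using ws by (auto simp: ws_eq reduced_Cons mean_minus_const)
      have r_split: "ev r x = ev (r - [:mean r:]) x + smul (mean r) 1" for x
        using alg_poly_add[of "r - [:mean r:]" "[:mean r:]" x] by (simp add: alg_poly_pCons)
      have "evaluation vs g * evaluation ws g = evaluation ((i, r - [:mean r:]) # ws') g + smul (mean r) (evaluation ws' g)"
        for g
      proof -
        have "evaluation vs g * evaluation ws g = ev r (a (g i)) * evaluation ws' g"
          using vs alg_poly_linear_mult[of "-\<alpha>" q]
          by (simp add: ws_eq evaluation_Cons r_def centering_def mult.assoc)
        then show ?thesis
          by (simp add: r_split evaluation_Cons distrib_right smul_mult_left)
      qed
      then show ?thesis using r ws' by (simp add: lin.intros)
    qed
  qed
  then show ?thesis by (simp add: ev_centering)
qed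

section \<open>Moments of words in the centered variables\<close>

definition bword :: "nat list \<Rightarrow> 'a" where "bword w = prod_list (map b w)"

lemma bword_simps [simp]: "bword [] = 1" "bword (i # w) = b i * bword w"
    "bword (v @ w) = bword v * bword w"
  by (simp_all add: bword_def)

lemma lin_bword: "set w \<subseteq> J \<Longrightarrow> lin (reduced J) (\<lambda>g. bword (map g w))"
proof (induction w)
  case Nil
  then show ?case using lin.word[of "[]" "reduced J"] by (simp add: evaluation_def[abs_def])
qed (auto intro: lin_b)

text \<open>Nonempty reduced words have expectation 0 and the empty word has expectation 1 for every
  admissible \<open>g\<close>, so only the coefficients remain.\<close>

lemma \<phi>_lin_reduced:
  assumes "lin (reduced J) F"
  shows "\<exists>c. \<forall>g. inj_on g J \<longrightarrow> g ` J \<subseteq> {1..} \<longrightarrow> \<phi> (F g) = c"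
  using assms
proof induction
  case (word ws)
  then show ?case by (cases "ws = []") (use \<phi>_evaluation_reduced in \<open>auto simp: unital\<close>)
next
  case (add F G)
  then obtain c d where "\<forall>g. inj_on g J \<longrightarrow> g ` J \<subseteq> {1..} \<longrightarrow> \<phi> (F g) = c"
    "\<forall>g. inj_on g J \<longrightarrow> g ` J \<subseteq> {1..} \<longrightarrow> \<phi> (G g) = d" by blast
  then show ?case by (intro exI[of _ "c + d"]) (auto simp: \<phi>_add)
next
  case (smul F c)
  then show ?case by (auto simp: \<phi>_smul)
qed auto

lemma \<phi>_lin_null:
  assumes "lin W F" "W \<subseteq> reduced J - {[]}" "inj_on g J" "g ` J \<subseteq> {1..}"
  shows "\<phi> (F g) = 0"
  using assms(1)
proof induction
  case (word ws)
  then show ?case using assms(2) \<phi>_evaluation_reduced[OF _ _ assms(3,4), of ws] by blast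
qed (simp_all add: \<phi>_add \<phi>_smul)

text \<open>Splitting off the empty word isolates the scalar \<open>c\<close>; for admissible
  \<open>g\<close> it is the expectation of \<open>F g\<close>, since \<open>\<phi>_lin_null\<close>
  removes the rest.\<close>

lemma lin_reduced_split:
  assumes "lin (reduced J) F"
  shows "\<exists>c F0. lin (reduced J - {[]}) F0 \<and> F = (\<lambda>g. smul c 1 + F0 g)"
  using assms
proof induction
  case zero
  show ?case by (intro exI[of _ 0] exI[of _ "\<lambda>g. 0"]) (auto intro: lin.zero)
next
  case (word ws)
  show ?case
  proof (cases "ws = []")
    case True
    then show ?thesis
      by (intro exI[of _ 1] exI[of _ "\<lambda>g. 0"]) (auto intro: lin.zero simp: evaluation_def)
  next
    case False
    then show ?thesis
      using word by (intro exI[of _ 0] exI[of _ "evaluation ws"]) (auto intro: lin.word)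
  qed
next
  case (add F G)
  then obtain c F0 d G0 where "lin (reduced J - {[]}) F0" "F = (\<lambda>g. smul c 1 + F0 g)"
    "lin (reduced J - {[]}) G0" "G = (\<lambda>g. smul d 1 + G0 g)" by blast
  then show ?case
    by (intro exI[of _ "c + d"] exI[of _ "\<lambda>g. F0 g + G0 g"])
      (auto intro: lin.add simp: scale_left_distrib)
next
  case (smul F c)
  then obtain d F0 where "lin (reduced J - {[]}) F0" "F = (\<lambda>g. smul d 1 + F0 g)" by blast
  then show ?case
    by (intro exI[of _ "c * d"] exI[of _ "\<lambda>g. smul c (F0 g)"])
      (auto intro: lin.smul simp: scale_right_distrib)
qed

definition word_moment :: "nat list \<Rightarrow> complex" where "word_moment w = \<phi> (bword w)"

lemma word_moment_Nil [simp]: "word_moment [] = 1"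
  by (simp add: word_moment_def unital)

lemma word_moment_relabel:
  assumes "inj_on g (set w)" "g ` set w \<subseteq> {1..}" "set w \<subseteq> {1..}"
  shows "word_moment (map g w) = word_moment w"
proof -
  obtain c where c: "\<And>g. inj_on g (set w) \<Longrightarrow> g ` set w \<subseteq> {1..} \<Longrightarrow> \<phi> (bword (map g w)) = c"
    using \<phi>_lin_reduced[OF lin_bword[of w "set w"]] by blast
  show ?thesis using c[of g] c[of id] assms by (simp add: word_moment_def)
qed

text \<open>By exchangeability, \<open>word_moment\<close> takes only finitely many values on words of a given length.\<close>

lemma word_moment_bounded: "\<exists>C. \<forall>w. length w = n \<longrightarrow> set w \<subseteq> {1..} \<longrightarrow> norm (word_moment w) \<le> C"
proof -
  define L where "L = {v. set v \<subseteq> {1..n} \<and> length v = n}"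
  have L: "finite L" unfolding L_def by (rule finite_lists_length_eq) simp
  show ?thesis
  proof (intro exI[of _ "\<Sum>v\<in>L. norm (word_moment v)"] allI impI)
    fix w :: "nat list" assume w: "length w = n" "set w \<subseteq> {1..}"
    have "card (set w) \<le> card {1..n}" using w card_length[of w] by simp
    then obtain g where g: "inj_on g (set w)" "g ` set w \<subseteq> {1..n}"
      using card_le_inj[of "set w" "{1..n}"] by auto
    then have "g ` set w \<subseteq> {1..}" by auto
    with g w have "word_moment (map g w) = word_moment w" by (intro word_moment_relabel) auto
    moreover have "map g w \<in> L" using g w by (auto simp: L_def)
    ultimately show "norm (word_moment w) \<le> (\<Sum>v\<in>L. norm (word_moment v))"
      using member_le_sum[of "map g w" L "\<lambda>v. norm (word_moment v)"] L by simp
  qed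
qed

text \<open>\<open>u\<close> and \<open>w\<close> expand into reduced words over \<open>J\<close>,
  none of which contains \<open>i\<close>. Placing the centered letter \<open>i\<close> between them
  gives nonempty reduced words, all annihilated by \<phi>.\<close>

lemma word_moment_singleton:
  assumes "i \<notin> set u" "i \<notin> set w" "set (u @ i # w) \<subseteq> {1..}"
  shows "word_moment (u @ i # w) = 0"
proof -
  define J where "J = set u \<union> set w"
  have "lin {u @ [(i, centering)] | u. u \<in> reduced J}
      (\<lambda>g. bword (map g u) * ev centering (a (g i)))"
    by (rule lin_mult_append[OF lin_bword lin_letter]) (auto simp: J_def)
  then have "lin {u @ [(i, centering)] @ w | u w. u \<in> reduced J \<and> w \<in> reduced J}
      (\<lambda>g. bword (map g u) * ev centering (a (g i)) * bword (map g w))"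
    by (rule lin_mult_append[OF _ lin_bword[where J = J]]) (auto simp: J_def, blast)
  then have "\<phi> (bword (map id u) * ev centering (a (id i)) * bword (map id w)) = 0"
    by (rule \<phi>_lin_null[where J = "insert i J"])
      (use assms in \<open>auto simp: J_def mean_centering intro!: reduced_append_Cons\<close>)
  then show ?thesis by (simp add: word_moment_def ev_centering mult.assoc)
qed

definition \<theta>2 :: complex where "\<theta>2 = \<phi> ((a 1)\<^sup>2) - \<alpha>\<^sup>2"

lemma mean_centering_square: "mean (centering * centering) = \<theta>2"
proof -
  have "centering * centering = [:\<alpha>\<^sup>2, -2 * \<alpha>, 1:]"
    by (simp add: centering_def power2_eq_square)
  then have "ev (centering * centering) (a 1)
      = smul (\<alpha>\<^sup>2) 1 + (smul (-2 * \<alpha>) (a 1) + (a 1)\<^sup>2)"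
    by (simp add: alg_poly_pCons distrib_left right_diff_distrib smul_mult_right power2_eq_square)
  then have "mean (centering * centering) = \<alpha>\<^sup>2 + (-2 * \<alpha> * \<alpha> + \<phi> ((a 1)\<^sup>2))"
    unfolding mean_def by (simp only: \<phi>_add \<phi>_smul unital \<alpha>_def mult_1_right)
  then show ?thesis by (simp add: \<theta>2_def power2_eq_square)
qed

text \<open>Write \<open>v\<close> as its mean plus a combination \<open>F0\<close> of nonempty
  reduced words. The mean brings the two letters \<open>i\<close> together and yields
  \<open>\<theta>2\<close>, whereas \<open>F0\<close> keeps them apart and contributes
  nothing.\<close>

lemma word_moment_pair:
  assumes "i \<notin> set v" "i \<notin> set w" "set (i # v @ i # w) \<subseteq> {1..}"
  shows "word_moment (i # v @ i # w) = \<theta>2 * word_moment v * word_moment w"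
proof -
  define J where "J = set v \<union> set w"
  have J: "i \<notin> J" "insert i J \<subseteq> {1..}" using assms by (auto simp: J_def)
  obtain c F0 where F0: "lin (reduced J - {[]}) F0" "(\<lambda>g. bword (map g v)) = (\<lambda>g. smul c 1 + F0 g)"
    using lin_reduced_split[OF lin_bword[of v J]] by (auto simp: J_def)
  have v: "bword v = smul c 1 + F0 id" using fun_cong[OF F0(2), of id] by simp
  have "\<phi> (F0 id) = 0" by (rule \<phi>_lin_null[OF F0(1), of J]) (use J in auto)
  then have c: "c = word_moment v" by (simp add: word_moment_def v \<phi>_add \<phi>_smul unital)
  have lin_w: "lin (reduced J) (\<lambda>g. bword (map g w))" by (rule lin_bword) (simp add: J_def)
  \<comment> \<open>\<open>q\<close> is the centered square: \<open>b i * b i\<close> is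
    \<open>ev q (a i)\<close> plus the scalar \<open>\<theta>2\<close>, and \<open>q\<close> in
    front of reduced words over \<open>J\<close> has expectation 0.\<close>
  define q where "q = centering * centering - [:\<theta>2:]"
  have q: "mean q = 0" using mean_minus_const[of "centering * centering"]
    by (simp add: q_def mean_centering_square)
  have "lin {(i, q) # w | w. w \<in> reduced J} (\<lambda>g. ev q (a (g i)) * bword (map g w))"
    by (rule lin_mult_append[OF lin_letter lin_w]) auto
  then have "\<phi> (ev q (a (id i)) * bword (map id w)) = 0"
    by (rule \<phi>_lin_null[where J = "insert i J"])
      (use J q reduced_append_Cons[where us = "[]"] in auto)
  moreover have "b i * b i = ev q (a i) + smul \<theta>2 1"
    using alg_poly_add[of q "[:\<theta>2:]" "a i"] alg_poly_linear_mult[of "-\<alpha>" centering "a i"]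
    by (simp add: q_def alg_poly_pCons flip: centering_def ev_centering)
  ultimately have 1: "\<phi> (b i * b i * bword w) = \<theta>2 * word_moment w"
    by (simp add: distrib_right smul_mult_left \<phi>_add \<phi>_smul word_moment_def)
  have "lin {(i, centering) # v | v. v \<in> reduced J - {[]}} (\<lambda>g. ev centering (a (g i)) * F0 g)"
    by (rule lin_mult_append[OF lin_letter F0(1)]) auto
  then have "lin {(i, centering) # v @ [(i, centering)] | v. v \<in> reduced J - {[]}}
      (\<lambda>g. ev centering (a (g i)) * F0 g * ev centering (a (g i)))"
    by (rule lin_mult_append[OF _ lin_letter]) auto
  then have "lin {(i, centering) # v @ (i, centering) # w | v w. v \<in> reduced J - {[]} \<and> w \<in> reduced J}
      (\<lambda>g. ev centering (a (g i)) * F0 g * ev centering (a (g i)) * bword (map g w))"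
    by (rule lin_mult_append[OF _ lin_w]) (auto, blast)
  \<comment> \<open>Here the empty word must be absent from \<open>F0\<close>: it would make the two
    letters \<open>i\<close> adjacent, and the result would not be reduced.\<close>
  then have "\<phi> (ev centering (a (id i)) * F0 id * ev centering (a (id i)) * bword (map id w)) = 0"
  proof (rule \<phi>_lin_null[where J = "insert i J"])
    have "(i, centering) # v @ (i, centering) # w \<in> reduced (insert i J)"
      if v: "v \<in> reduced J" "v \<noteq> []" and w: "w \<in> reduced J" for v w
    proof -
      have "fst (hd v) \<in> J" using v by (cases v) (auto simp: reduced_def)
      moreover have "v @ (i, centering) # w \<in> reduced (insert i J)"
        by (intro reduced_append_Cons v w J mean_centering)
      ultimately show ?thesis
        using v J by (auto simp: reduced_Cons mean_centering)
    qed
    then show "{(i, centering) # v @ (i, centering) # w |v w. v \<in> reduced J - {[]} \<and> w \<in> reduced J}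
        \<subseteq> reduced (insert i J) - {[]}" by auto
  qed (use J in auto)
  then have 2: "\<phi> (b i * F0 id * b i * bword w) = 0" by (simp add: ev_centering)
  have "bword (i # v @ i # w) = smul c (b i * b i * bword w) + b i * F0 id * b i * bword w"
    by (simp add: v distrib_left distrib_right smul_mult_left smul_mult_right mult.assoc)
  then show ?thesis
    by (simp add: word_moment_def[of "i # v @ i # w"] \<phi>_add \<phi>_smul 1 2 c)
qed

end

section \<open>Moments of partial sums\<close>

definition words :: "nat set \<Rightarrow> nat \<Rightarrow> nat list set" where
  "words I n = {w. set w \<subseteq> I \<and> length w = n}"

lemma finite_words: "finite I \<Longrightarrow> finite (words I n)"
  unfolding words_def by (rule finite_lists_length_eq)

lemma card_words: "finite I \<Longrightarrow> card (words I n) = card I ^ n"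
  unfolding words_def by (rule card_lists_length_eq)

lemma words_0: "words I 0 = {[]}"
  by (auto simp: words_def)

lemma words_Suc: "words I (Suc n) = (\<lambda>(i, w). i # w) ` (I \<times> words I n)"
  by (auto simp: words_def length_Suc_conv)

text \<open>A word with at most \<open>d\<close> distinct letters is coded by a list
  \<open>u\<close> of \<open>d\<close> letters and a word of positions in \<open>u\<close>; there
  are \<open>card I ^ d\<close> and \<open>d ^ n\<close> of these.\<close>

lemma card_words_few_letters:
  assumes "finite I"
  shows "card {w \<in> words I n. w \<noteq> [] \<and> card (set w) \<le> d} \<le> d ^ n * card I ^ d"
proof -
  have "{w \<in> words I n. w \<noteq> [] \<and> card (set w) \<le> d}
      \<subseteq> (\<lambda>(v, u). map ((!) u) v) ` (words {..<d} n \<times> words I d)"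
  proof safe
    fix w assume w: "w \<in> words I n" "w \<noteq> []" "card (set w) \<le> d"
    \<comment> \<open>Padding with \<open>hd w\<close> makes the length exactly \<open>d\<close>
      without leaving \<open>I\<close>; this is where \<open>w\<close> has to be nonempty.\<close>
    define u where "u = remdups w @ replicate (d - card (set w)) (hd w)"
    have u: "length u = d" "set w \<subseteq> set u" "set u \<subseteq> I"
      using w by (auto simp: u_def words_def length_remdups_card_conv split: if_splits)
    then have "\<forall>x\<in>set w. \<exists>j<d. u ! j = x" by (auto simp: in_set_conv_nth subset_iff)
    then obtain r where r: "\<And>x. x \<in> set w \<Longrightarrow> r x < d \<and> u ! r x = x" by metis
    have "w = map ((!) u) (map r w)" using r by (induction w) auto
    moreover have "map r w \<in> words {..<d} n" using w r by (auto simp: words_def)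
    moreover have "u \<in> words I d" using u by (simp add: words_def)
    ultimately show "w \<in> (\<lambda>(v, u). map ((!) u) v) ` (words {..<d} n \<times> words I d)"
      by (auto intro!: image_eqI[of _ _ "(map r w, u)"])
  qed
  then have "card {w \<in> words I n. w \<noteq> [] \<and> card (set w) \<le> d}
      \<le> card (words {..<d} n \<times> words I d)"
    using assms by (intro surj_card_le finite_cartesian_product finite_words) auto
  then show ?thesis using assms by (simp add: card_cartesian_product card_words)
qed

text \<open>Factor out \<open>x - y\<close> and bound each of the \<open>n\<close> terms of the
  cofactor by \<open>z ^ (n - 1)\<close>. For \<open>n = 0\<close> the truncated exponent is
  harmless, both sides being 0.\<close>

lemma abs_power_diff_le:
  fixes x y z :: real
  assumes "0 \<le> x" "x \<le> z" "0 \<le> y" "y \<le> z"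
  shows "\<bar>x ^ n - y ^ n\<bar> \<le> real n * \<bar>x - y\<bar> * z ^ (n - 1)"
proof (cases n)
  case (Suc m)
  have eq: "\<bar>x ^ n - y ^ n\<bar> = \<bar>x - y\<bar> * \<bar>\<Sum>p<Suc m. x ^ p * y ^ (m - p)\<bar>"
    unfolding Suc diff_power_eq_sum abs_mult ..
  have "\<bar>\<Sum>p<Suc m. x ^ p * y ^ (m - p)\<bar> \<le> (\<Sum>p<Suc m. z ^ m)"
  proof (rule order.trans[OF sum_abs], rule sum_mono)
    fix p assume "p \<in> {..<Suc m}"
    have "\<bar>x ^ p * y ^ (m - p)\<bar> \<le> z ^ p * z ^ (m - p)"
      using assms by (auto simp: abs_mult intro!: mult_mono power_mono)
    also have "\<dots> = z ^ m" using \<open>p \<in> _\<close> by (simp flip: power_add)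
    finally show "\<bar>x ^ p * y ^ (m - p)\<bar> \<le> z ^ m" .
  qed
  then have "\<bar>x ^ n - y ^ n\<bar> \<le> \<bar>x - y\<bar> * (\<Sum>p<Suc m. z ^ m)"
    unfolding eq by (rule mult_left_mono) simp
  then show ?thesis by (simp add: Suc algebra_simps)
qed simp

context free_identical
begin

section \<open>Catalan recursion for the moments of centered sums\<close>

definition T :: "nat set \<Rightarrow> 'a" where "T I = (\<Sum>i\<in>I. b i)"

definition sum_moment :: "nat set \<Rightarrow> nat \<Rightarrow> complex" where "sum_moment I n = \<phi> (T I ^ n)"

lemma T_power: "finite I \<Longrightarrow> T I ^ n = (\<Sum>w\<in>words I n. bword w)"
proof (induction n)
  case (Suc n)
  have "(\<Sum>w\<in>words I (Suc n). bword w) = (\<Sum>(i, w)\<in>I \<times> words I n. bword (i # w))"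
    unfolding words_Suc by (subst sum.reindex) (auto simp: inj_on_def split_beta)
  also have "\<dots> = T I * (\<Sum>w\<in>words I n. bword w)"
    by (simp add: T_def sum_product sum.cartesian_product)
  finally show ?case using Suc by simp
qed (simp add: words_0)

lemma sum_moment_eq: "finite I \<Longrightarrow> sum_moment I n = (\<Sum>w\<in>words I n. word_moment w)"
  by (simp add: sum_moment_def T_power \<phi>_sum word_moment_def)

lemma sum_moment_zero [simp]: "sum_moment I 0 = 1"
  by (simp add: sum_moment_def unital)

lemma sum_moment_empty: "sum_moment {} n = 0 ^ n"
  by (cases n) (simp_all add: sum_moment_def T_def unital)

lemma sum_moment_one: "finite I \<Longrightarrow> I \<subseteq> {1..} \<Longrightarrow> sum_moment I (Suc 0) = 0"
  unfolding sum_moment_eq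
proof (rule sum.neutral, rule ballI)
  fix w assume I: "I \<subseteq> {1..}" and "w \<in> words I (Suc 0)"
  then obtain i where "i \<in> I" "w = [i]" by (auto simp: words_def length_Suc_conv)
  with I show "word_moment w = 0" using word_moment_singleton[of i "[]" "[]"] by auto
qed

definition crowded :: "nat set \<Rightarrow> nat \<Rightarrow> nat list set" where
  "crowded I n = {w \<in> words I n. w \<noteq> [] \<and> count_list w (hd w) \<ge> 3}"

text \<open>A letter occurring once makes the moment vanish, so every letter occurs at least twice
  and the first one at least three times; counting positions gives
  \<open>2 * card (set w) + 1 \<le> n\<close>.\<close>

lemma crowded_few_letters:
  assumes "w \<in> crowded I n" "word_moment w \<noteq> 0" "I \<subseteq> {1..}"
  shows "card (set w) \<le> (n - 1) div 2"
proof -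
  have w: "w \<noteq> []" "set w \<subseteq> I" "length w = n" "count_list w (hd w) \<ge> 3"
    using assms by (auto simp: crowded_def words_def)
  have two: "count_list w x \<ge> 2" if x: "x \<in> set w" for x
  proof (rule ccontr)
    assume "\<not> count_list w x \<ge> 2"
    moreover have "count_list w x \<noteq> 0" using x by (simp add: count_list_0_iff)
    ultimately have "count_list w x = 1" by simp
    moreover obtain u v where "w = u @ x # v" using x by (meson split_list)
    ultimately have "x \<notin> set u" "x \<notin> set v" "w = u @ x # v" by (auto simp: count_list_0_iff)
    with word_moment_singleton[of x u v] w assms show False by auto
  qed
  have "2 * card (set w) + 1 = (\<Sum>x\<in>set w. 2 + (if x = hd w then 1 else 0))"
    using w by (simp only: sum.distrib) simp
  also have "\<dots> \<le> (\<Sum>x\<in>set w. count_list w x)"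
  proof (rule sum_mono)
    fix x assume "x \<in> set w"
    from two[OF this] w(4) show "2 + (if x = hd w then 1 else 0) \<le> count_list w x"
      by (cases "x = hd w") auto
  qed
  also have "\<dots> = n" using w by (simp add: sum_count_set)
  finally show ?thesis by simp
qed

text \<open>Only words with at most \<open>(n - 1) div 2\<close> letters contribute, and their
  moments are uniformly bounded. For \<open>n \<ge> 1\<close> this exponent is below n/2, which
  makes crowded words negligible against \<open>sqrt (card I) ^ n\<close>.\<close>

lemma crowded_bound:
  "\<exists>C\<ge>0. \<forall>I. finite I \<longrightarrow> I \<subseteq> {1..} \<longrightarrow>
    norm (\<Sum>w\<in>crowded I n. word_moment w) \<le> C * real (card I) ^ ((n - 1) div 2)"
proof -
  obtain B where B: "\<And>w. length w = n \<Longrightarrow> set w \<subseteq> {1..} \<Longrightarrow> norm (word_moment w) \<le> B"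
    using word_moment_bounded[of n] by blast
  define d where "d = (n - 1) div 2"
  have "norm (\<Sum>w\<in>crowded I n. word_moment w) \<le> \<bar>B\<bar> * real (d ^ n) * real (card I) ^ d"
    if I: "finite I" "I \<subseteq> {1..}" for I
  proof -
    define W where "W = {w \<in> words I n. w \<noteq> [] \<and> card (set w) \<le> d}"
    have fin: "finite (crowded I n)" "finite W"
      using finite_words[OF I(1)] by (simp_all add: crowded_def W_def)
    have "(\<Sum>w\<in>crowded I n. word_moment w) = (\<Sum>w\<in>crowded I n \<inter> W. word_moment w)"
      using crowded_few_letters[OF _ _ I(2)] fin
      by (intro sum.mono_neutral_right) (auto simp: W_def d_def crowded_def)
    also have "norm \<dots> \<le> real (card (crowded I n \<inter> W)) * \<bar>B\<bar>"
    proof (rule sum_norm_bound)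
      fix w assume "w \<in> crowded I n \<inter> W"
      then have "norm (word_moment w) \<le> B" using I by (intro B) (auto simp: W_def words_def)
      then show "norm (word_moment w) \<le> \<bar>B\<bar>" by simp
    qed
    also have "card (crowded I n \<inter> W) \<le> card W" using fin by (intro card_mono) auto
    also have "\<dots> \<le> d ^ n * card I ^ d"
      unfolding W_def by (rule card_words_few_letters[OF I(1)])
    finally show ?thesis by (simp add: mult_left_mono mult_ac)
  qed
  then show ?thesis
    by (intro exI[of _ "\<bar>B\<bar> * real (d ^ n)"]) (simp add: d_def)
qed

text \<open>If the first letter \<open>i\<close> occurs exactly twice, \<open>p\<close> is the
  length of the gap between its occurrences. The two remaining pieces avoid \<open>i\<close>, hence
  \<open>I - {i}\<close>; the identity is exact, and passing to \<open>I\<close> is left to the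
  asymptotics.\<close>

lemma sum_moment_recursion:
  assumes I: "finite I" "I \<subseteq> {1..}"
  shows "sum_moment I (n + 2) = \<theta>2 * (\<Sum>i\<in>I. \<Sum>p\<le>n. sum_moment (I - {i}) p * sum_moment (I - {i}) (n - p))
    + (\<Sum>w\<in>crowded I (n + 2). word_moment w)"
proof -
  define W1 where "W1 = {w \<in> words I (n + 2). count_list w (hd w) = 1}"
  define W2 where "W2 = {w \<in> words I (n + 2). count_list w (hd w) = 2}"
  have fin: "finite W1" "finite W2" "finite (crowded I (n + 2))"
    using finite_words[OF I(1)] by (simp_all add: crowded_def W1_def W2_def)
  have "count_list w (hd w) \<noteq> 0" if "w \<in> words I (n + 2)" for w
    using that by (cases w) (auto simp: words_def)
  then have "words I (n + 2) = W1 \<union> W2 \<union> crowded I (n + 2)"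
    by (force simp: W1_def W2_def crowded_def words_def)
  then have "sum_moment I (n + 2) = (\<Sum>w\<in>W1. word_moment w) + (\<Sum>w\<in>W2. word_moment w) + (\<Sum>w\<in>crowded I (n + 2). word_moment w)"
    unfolding sum_moment_eq[OF I(1)]
    by (simp only:) (use fin in \<open>subst sum.union_disjoint; force simp: W1_def W2_def crowded_def
      intro!: sum.union_disjoint\<close>)
  also have "(\<Sum>w\<in>W1. word_moment w) = 0"
  proof (rule sum.neutral, rule ballI)
    fix w assume w: "w \<in> W1"
    then obtain i v where "w = i # v" by (cases w) (auto simp: W1_def words_def)
    with w I show "word_moment w = 0" using word_moment_singleton[of i "[]" v]
      by (auto simp: W1_def words_def count_list_0_iff)
  qed
  also have "(\<Sum>w\<in>W2. word_moment w) = (\<Sum>(i, p, v, z)\<in>(SIGMA i:I. SIGMA p:{..n}.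
      words (I - {i}) p \<times> words (I - {i}) (n - p)). word_moment (i # v @ i # z))"
  proof -
    let ?S = "SIGMA i:I. SIGMA p:{..n}. words (I - {i}) p \<times> words (I - {i}) (n - p)"
    let ?F = "\<lambda>(i, p, v, z). i # v @ i # z"
    \<comment> \<open>Since \<open>v\<close> avoids \<open>i\<close>, the end of \<open>v\<close> is
      marked by the first \<open>i\<close> after the head, so the word determines \<open>v\<close>
      and \<open>z\<close>.\<close>
    have "inj_on ?F ?S"
      by (auto simp: inj_on_def words_def subset_Diff_insert append_Cons_eq_iff)
    moreover have "?F ` ?S = W2"
    proof
      show "?F ` ?S \<subseteq> W2"
        by (auto simp: W2_def words_def count_list_0_iff subset_iff)
      show "W2 \<subseteq> ?F ` ?S"
      proof
        fix w assume w: "w \<in> W2"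
        then obtain i w' where w': "w = i # w'" by (cases w) (auto simp: W2_def words_def)
        with w have count: "count_list w' i = 1" by (simp add: W2_def)
        then have "i \<in> set w'" using count_notin[of i w'] by force
        then obtain v z where vz: "w' = v @ i # z" by (meson split_list)
        with count have "i \<notin> set v" "i \<notin> set z" by (auto simp: count_list_0_iff)
        then have "(i, length v, v, z) \<in> ?S" using w w' vz by (auto simp: W2_def words_def)
        then show "w \<in> ?F ` ?S" using w' vz by (intro image_eqI[of _ _ "(i, length v, v, z)"]) auto
      qed
    qed
    ultimately have "(\<Sum>w\<in>W2. word_moment w) = sum (word_moment \<circ> ?F) ?S"
      using sum.reindex[of ?F ?S word_moment] by simp
    then show ?thesis by (simp add: comp_def split_beta)
  qed
  also have "\<dots> = (\<Sum>(i, p, v, z)\<in>(SIGMA i:I. SIGMA p:{..n}.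
      words (I - {i}) p \<times> words (I - {i}) (n - p)). \<theta>2 * (word_moment v * word_moment z))"
    using I by (intro sum.cong refl) (auto simp: words_def subset_iff intro!: word_moment_pair[simplified mult.assoc])
  also have "\<dots> = \<theta>2 * (\<Sum>i\<in>I. \<Sum>p\<le>n. sum_moment (I - {i}) p * sum_moment (I - {i}) (n - p))"
  proof -
    have "\<theta>2 * (\<Sum>i\<in>I. \<Sum>p\<le>n. sum_moment (I - {i}) p * sum_moment (I - {i}) (n - p))
      = (\<Sum>i\<in>I. \<Sum>p\<le>n. \<Sum>(v, z)\<in>words (I - {i}) p \<times> words (I - {i}) (n - p). \<theta>2 * (word_moment v * word_moment z))"
    proof -
      have fin: "finite (I - {i})" for i using I by simp
      have "sum_moment (I - {i}) p * sum_moment (I - {i}) q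
          = (\<Sum>(v, z)\<in>words (I - {i}) p \<times> words (I - {i}) q. word_moment v * word_moment z)" for i p q
        by (simp only: sum_moment_eq[OF fin] sum_product sum.cartesian_product)
      then show ?thesis
        by (simp add: sum_distrib_left split_beta')
    qed
    also have "\<dots> = (\<Sum>i\<in>I. \<Sum>(p, v, z)\<in>(SIGMA p:{..n}.
      words (I - {i}) p \<times> words (I - {i}) (n - p)). \<theta>2 * (word_moment v * word_moment z))"
      using I by (intro sum.cong[OF refl] sum.Sigma) (simp_all add: finite_words)
    also have "\<dots> = (\<Sum>(i, p, v, z)\<in>(SIGMA i:I. SIGMA p:{..n}.
      words (I - {i}) p \<times> words (I - {i}) (n - p)). \<theta>2 * (word_moment v * word_moment z))"
      using I by (intro sum.Sigma) (simp_all add: finite_words)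
    finally show ?thesis ..
  qed
  finally show ?thesis by simp
qed

text \<open>The leading coefficients \<open>r ^ n * c n\<close> solve the Catalan recursion with
  weight \<open>\<theta>2\<close>, and strong induction propagates the errors. The factor
  \<open>sqrt (card I)\<close> on the left expresses the gain of one power without negative
  exponents.\<close>

lemma sum_moment_asymptotic:
  fixes c :: "nat \<Rightarrow> complex" and r :: complex
  assumes r: "r\<^sup>2 = \<theta>2"
    and c: "c 0 = 1" "c 1 = 0" "\<And>n. c (n + 2) = (\<Sum>p\<le>n. c p * c (n - p))"
  shows "\<exists>C\<ge>0. \<forall>I. finite I \<longrightarrow> I \<subseteq> {1..} \<longrightarrow> sqrt (card I) *
    norm (sum_moment I n - r ^ n * c n * of_real (sqrt (card I)) ^ n) \<le> C * sqrt (card I) ^ n"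
proof (induction n rule: less_induct)
  case (less n)
  define M where "M n = r ^ n * c n" for n
  have M: "M 0 = 1" "M (Suc 0) = 0"
    using c by (simp_all add: M_def)
  have M_rec: "M (n + 2) = \<theta>2 * (\<Sum>p\<le>n. M p * M (n - p))" for n
  proof -
    have "M (n + 2) = r\<^sup>2 * (\<Sum>p\<le>n. r ^ n * (c p * c (n - p)))"
      unfolding M_def c by (simp add: power_add sum_distrib_left mult_ac power2_eq_square)
    also have "(\<Sum>p\<le>n. r ^ n * (c p * c (n - p))) = (\<Sum>p\<le>n. M p * M (n - p))"
    proof (rule sum.cong[OF refl])
      fix p assume "p \<in> {..n}"
      then have "r ^ n = r ^ p * r ^ (n - p)" by (simp flip: power_add)
      then show "r ^ n * (c p * c (n - p)) = M p * M (n - p)" by (simp add: M_def)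
    qed
    finally show ?thesis by (simp add: r)
  qed
  consider "n = 0" | "n = 1" | l where "n = l + 2"
    by (metis One_nat_def Suc_1 add_2_eq_Suc' not0_implies_Suc)
  then show ?case
  proof cases
    case 1
    then show ?thesis using c by (intro exI[of _ 0]) auto
  next
    case 2
    then show ?thesis using c sum_moment_one by (intro exI[of _ 0]) auto
  next
    case (3 l)
    have "\<forall>p. \<exists>C. p < n \<longrightarrow> C \<ge> 0 \<and> (\<forall>I. finite I \<longrightarrow> I \<subseteq> {1..} \<longrightarrow> sqrt (card I) *
      norm (sum_moment I p - M p * of_real (sqrt (card I)) ^ p) \<le> C * sqrt (card I) ^ p)"
      using less unfolding M_def by blast
    then obtain C where C: "\<And>p. p < n \<Longrightarrow> C p \<ge> 0"
      "\<And>p I. p < n \<Longrightarrow> finite I \<Longrightarrow> I \<subseteq> {1..} \<Longrightarrow>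
        sqrt (card I) * norm (sum_moment I p - M p * of_real (sqrt (card I)) ^ p) \<le> C p * sqrt (card I) ^ p"
      by metis
    define D where "D = (\<Sum>p\<le>l. C p)"
    define K where "K = (\<Sum>p\<le>l. norm (M p))"
    have D: "C p \<le> D" if "p \<le> l" for p
      unfolding D_def using that C(1) 3 by (intro member_le_sum) auto
    have K: "norm (M p) \<le> K" if "p \<le> l" for p
      unfolding K_def using that by (intro member_le_sum) auto
    have D0: "D \<ge> 0" and K0: "K \<ge> 0"
      unfolding D_def K_def using C(1) 3 by (auto intro!: sum_nonneg)
    \<comment> \<open>\<open>2 * D\<close> pays for the induction error, \<open>K * l\<close> for
      replacing \<open>card I - 1\<close> by \<open>card I\<close>, and the remaining
      \<open>K + 1\<close> for the case that \<open>I - {i}\<close> is empty.\<close>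
    define D' where "D' = 2 * D + K * (l + 1) + 1"
    have D'0: "D' \<ge> 0" using D0 K0 by (simp add: D'_def)
    obtain E where E: "E \<ge> 0" "\<And>I. finite I \<Longrightarrow> I \<subseteq> {1..} \<Longrightarrow>
        norm (\<Sum>w\<in>crowded I n. word_moment w) \<le> E * real (card I) ^ ((n - 1) div 2)"
      using crowded_bound[of n] by blast
    define F where "F = norm \<theta>2 * ((l + 1) * (D' * (D' + K) + K * D')) + E"
    have "sqrt (card I) * norm (sum_moment I n - M n * of_real (sqrt (card I)) ^ n) \<le> F * sqrt (card I) ^ n"
      if I: "finite I" "I \<subseteq> {1..}" for I
    proof (cases "I = {}")
      case True
      then show ?thesis by (simp add: 3)
    next
      case False
      define x where "x = sqrt (card I)"
      have card1: "card I \<ge> 1" using False I by (simp add: Suc_leI card_gt_0_iff)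
      then have x1: "x \<ge> 1" by (simp add: x_def)
      have xx: "x * x = card I" by (simp add: x_def)
      \<comment> \<open>Removing an index changes the root \<open>x\<close> to \<open>y\<close> with
        \<open>x * x - y * y = 1\<close>, hence \<open>x * (x - y) \<le> 1\<close>; so the
        normalization by \<open>x\<close> can be kept.\<close>
      have step_a: "x * norm (sum_moment (I - {i}) p - M p * of_real x ^ p) \<le> D' * x ^ p"
        if i: "i \<in> I" and p: "p \<le> l" for i p
      proof (cases "I - {i} = {}")
        case True
        with i have "I = {i}" by auto
        then have "x = 1" by (simp add: x_def)
        moreover have "norm (0 ^ p - M p) \<le> 1 + K"
          by (rule order.trans[OF norm_triangle_ineq4]) (use K[OF p] in \<open>auto simp: power_0_left\<close>)
        moreover have "1 + K \<le> D'" using D0 K0 by (simp add: D'_def algebra_simps)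
        ultimately show ?thesis unfolding True sum_moment_empty by simp
      next
        case False
        define y where "y = sqrt (card (I - {i}))"
        have fin: "finite (I - {i})" using I by simp
        have yy: "y * y = x * x - 1"
          using card1 by (simp add: y_def xx card_Diff_singleton[OF i] of_nat_diff)
        have y1: "y \<ge> 1" using False fin by (simp add: y_def Suc_leI card_gt_0_iff)
        have yx: "y \<le> x"
          using fin card_mono[OF I(1), of "I - {i}"] by (auto simp: y_def x_def)
        \<comment> \<open>From \<open>y \<ge> 1\<close> follows
          \<open>4 * y * y \<ge> y * y + 1 = x * x\<close>. This trades the prefactor
          \<open>x\<close> for \<open>2 * y\<close>, to which the induction hypothesis
          applies.\<close>
        have "(2 * y) * (2 * y) \<ge> x * x" using yy y1 mult_mono[of 1 y 1 y] by simp
        then have x2y: "x \<le> 2 * y"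
          using y1 by (auto intro: power2_le_imp_le[unfolded power2_eq_square])
        have xy: "x * (x - y) \<le> 1"
        proof -
          have "x * (x - y) \<le> (x + y) * (x - y)" using yx y1 by (intro mult_right_mono) auto
          also have "\<dots> = 1" using yy by (simp add: algebra_simps)
          finally show ?thesis .
        qed
        have "sum_moment (I - {i}) p - M p * of_real x ^ p
            = (sum_moment (I - {i}) p - M p * of_real y ^ p) + M p * of_real (y ^ p - x ^ p)"
          by (simp add: algebra_simps)
        then have "norm (sum_moment (I - {i}) p - M p * of_real x ^ p)
          \<le> norm (sum_moment (I - {i}) p - M p * of_real y ^ p) + norm (M p * of_real (y ^ p - x ^ p))"
          by (simp only: norm_triangle_ineq)
        then have "x * norm (sum_moment (I - {i}) p - M p * of_real x ^ p)
          \<le> x * (norm (sum_moment (I - {i}) p - M p * of_real y ^ p) + norm (M p * of_real (y ^ p - x ^ p)))"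
          using x1 by (intro mult_left_mono) auto
        also have "\<dots> = x * norm (sum_moment (I - {i}) p - M p * of_real y ^ p)
            + norm (M p) * (x * \<bar>y ^ p - x ^ p\<bar>)"
          by (simp only: norm_mult norm_of_real distrib_left mult_ac)
        also have "x * norm (sum_moment (I - {i}) p - M p * of_real y ^ p)
          \<le> 2 * (y * norm (sum_moment (I - {i}) p - M p * of_real y ^ p))"
          using mult_right_mono[OF x2y norm_ge_zero] by (simp add: mult.assoc)
        also have "\<dots> \<le> 2 * (D * x ^ p)"
        proof -
          have "y * norm (sum_moment (I - {i}) p - M p * of_real y ^ p) \<le> C p * y ^ p"
            unfolding y_def by (rule C(2)) (use I p 3 in auto)
          also have "\<dots> \<le> D * x ^ p"
            using D[OF p] D0 yx y1 by (intro mult_mono power_mono) auto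
          finally show ?thesis by simp
        qed
        also have "x * \<bar>y ^ p - x ^ p\<bar> \<le> real l * x ^ p"
        proof (cases p)
          case (Suc q)
          have "x * \<bar>y ^ p - x ^ p\<bar> \<le> x * (real p * \<bar>y - x\<bar> * x ^ q)"
            using abs_power_diff_le[of y x x p] yx y1 x1 by (intro mult_left_mono) (auto simp: Suc)
          also have "\<dots> = real p * x ^ q * (x * (x - y))" using yx by (simp add: mult_ac)
          also have "\<dots> \<le> real p * x ^ q * 1" using xy x1 by (intro mult_left_mono) auto
          also have "real p * x ^ q * 1 = real p * x ^ q" by simp
          also have "\<dots> \<le> real l * x ^ p"
            using x1 p Suc power_increasing[of q p x] by (intro mult_mono) auto
          finally show ?thesis by simp
        qed (use x1 in auto)
        finally have "x * norm (sum_moment (I - {i}) p - M p * of_real x ^ p)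
            \<le> 2 * (D * x ^ p) + norm (M p) * (real l * x ^ p)"
          using D0 x1 by (simp add: mult_left_mono)
        also have "\<dots> \<le> 2 * (D * x ^ p) + K * (real l * x ^ p)"
          using K[OF p] x1 by (intro add_left_mono mult_right_mono) auto
        also have "\<dots> \<le> D' * x ^ p"
          using x1 K0 by (simp add: D'_def algebra_simps)
        finally show ?thesis .
      qed
      \<comment> \<open>The products are compared through
        \<open>(u - u') * v + u' * (v - v')\<close>, where each summand has one small
        factor.\<close>
      have step_b: "x * norm (sum_moment (I - {i}) p * sum_moment (I - {i}) (l - p) - M p * M (l - p) * of_real x ^ l)
          \<le> (D' * (D' + K) + K * D') * x ^ l"
        if i: "i \<in> I" and p: "p \<le> l" for i p
      proof -
        define q where "q = l - p"
        have q: "q \<le> l" and l: "x ^ l = x ^ p * x ^ q" "(of_real x :: complex) ^ l = of_real x ^ p * of_real x ^ q"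
          using p by (simp_all add: q_def flip: power_add)
        define u v where "u = sum_moment (I - {i}) p" and "v = sum_moment (I - {i}) q"
        define u' v' where "u' = M p * of_real x ^ p" and "v' = M q * of_real x ^ q"
        have u: "x * norm (u - u') \<le> D' * x ^ p" and v: "x * norm (v - v') \<le> D' * x ^ q"
          unfolding u_def u'_def v_def v'_def by (rule step_a[OF i p], rule step_a[OF i q])
        have u': "norm u' \<le> K * x ^ p" and v': "norm v' \<le> K * x ^ q"
          unfolding u'_def v'_def using K[OF p] K[OF q] x1
          by (simp_all add: norm_mult norm_power mult_right_mono)
        have "1 * norm (v - v') \<le> x * norm (v - v')" using x1 by (intro mult_right_mono) auto
        with v v' norm_triangle_sub[of v v'] have vn: "norm v \<le> (D' + K) * x ^ q"
          by (simp add: distrib_right)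
        have "u * v - u' * v' = (u - u') * v + u' * (v - v')" by (simp add: algebra_simps)
        then have "norm (u * v - u' * v') \<le> norm (u - u') * norm v + norm u' * norm (v - v')"
          by (simp only: norm_triangle_ineq flip: norm_mult)
        then have "x * norm (u * v - u' * v') \<le> x * (norm (u - u') * norm v + norm u' * norm (v - v'))"
          using x1 by (intro mult_left_mono) auto
        also have "\<dots> = x * norm (u - u') * norm v + norm u' * (x * norm (v - v'))"
          by (simp add: algebra_simps)
        also have "\<dots> \<le> (D' * x ^ p) * ((D' + K) * x ^ q) + (K * x ^ p) * (D' * x ^ q)"
          using x1 D'0 K0 by (intro add_mono mult_mono[OF u vn] mult_mono[OF u' v]) auto
        also have "\<dots> = (D' * (D' + K) + K * D') * x ^ l"
          by (simp add: l algebra_simps)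
        also have "u' * v' = M p * M (l - p) * of_real x ^ l"
          by (simp add: u'_def v'_def l flip: q_def)
        finally show ?thesis by (simp add: u_def v_def q_def)
      qed
      define Z where "Z i p = sum_moment (I - {i}) p * sum_moment (I - {i}) (l - p) - M p * M (l - p) * of_real x ^ l" for i p
      define G where "G = D' * (D' + K) + K * D'"
      \<comment> \<open>The sum over \<open>i\<close> contributes \<open>card I = x * x\<close>, the
        two powers by which \<open>n\<close> exceeds \<open>l\<close>.\<close>
      have "M n * of_real x ^ n = \<theta>2 * (\<Sum>i\<in>I. \<Sum>p\<le>l. M p * M (l - p) * of_real x ^ l)"
      proof -
        have "(of_real x :: complex) ^ n = of_nat (card I) * of_real x ^ l"
          using arg_cong[OF xx, of "of_real :: real \<Rightarrow> complex"] by (simp add: 3)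
        moreover have "M n = \<theta>2 * (\<Sum>p\<le>l. M p * M (l - p))" unfolding 3 by (rule M_rec)
        ultimately show ?thesis
          by (simp only: sum_distrib_right sum_distrib_left sum_constant mult_ac)
      qed
      then have "sum_moment I n - M n * of_real x ^ n = \<theta>2 * (\<Sum>i\<in>I. \<Sum>p\<le>l. Z i p) + (\<Sum>w\<in>crowded I n. word_moment w)"
        by (simp only: 3 sum_moment_recursion[OF I] Z_def sum_subtractf) (simp add: algebra_simps)
      then have "x * norm (sum_moment I n - M n * of_real x ^ n)
          \<le> x * (norm \<theta>2 * (\<Sum>i\<in>I. \<Sum>p\<le>l. norm (Z i p)) + norm (\<Sum>w\<in>crowded I n. word_moment w))"
        using x1 by (auto intro!: mult_left_mono norm_triangle_le add_mono sum_norm_le simp: norm_mult)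
      also have "\<dots> = norm \<theta>2 * (\<Sum>i\<in>I. \<Sum>p\<le>l. x * norm (Z i p)) + x * norm (\<Sum>w\<in>crowded I n. word_moment w)"
        by (simp add: sum_distrib_left algebra_simps)
      also have "(\<Sum>i\<in>I. \<Sum>p\<le>l. x * norm (Z i p)) \<le> (\<Sum>i\<in>I. \<Sum>p\<le>l. G * x ^ l)"
        unfolding Z_def G_def by (intro sum_mono step_b) auto
      also have "(\<Sum>i\<in>I. \<Sum>p\<le>l. G * x ^ l) = (l + 1) * G * x ^ n"
        by (simp add: 3 flip: xx)
      \<comment> \<open>As \<open>2 * d \<le> n - 1\<close>, the crowded words lose a full power of
        \<open>x\<close>.\<close>
      also have "x * norm (\<Sum>w\<in>crowded I n. word_moment w) \<le> E * x ^ n"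
      proof -
        define d where "d = (n - 1) div 2"
        have "norm (\<Sum>w\<in>crowded I n. word_moment w) \<le> E * real (card I) ^ d"
          using E(2)[OF I] by (simp add: d_def)
        also have "\<dots> = E * x ^ (2 * d)" by (simp add: power_mult power2_eq_square xx)
        also have "\<dots> \<le> E * x ^ (n - 1)"
          using x1 E(1) by (intro mult_left_mono power_increasing) (auto simp: d_def)
        finally have "x * norm (\<Sum>w\<in>crowded I n. word_moment w) \<le> x * (E * x ^ (n - 1))"
          using x1 by (intro mult_left_mono) auto
        then show ?thesis by (simp add: 3 mult_ac)
      qed
      finally have "x * norm (sum_moment I n - M n * of_real x ^ n)
          \<le> norm \<theta>2 * ((l + 1) * G * x ^ n) + E * x ^ n"
        by (simp add: mult_left_mono)
      also have "\<dots> = F * x ^ n" by (simp add: F_def G_def algebra_simps)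
      finally show ?thesis by (simp only: x_def)
    qed
    moreover have "F \<ge> 0" using D'0 K0 E(1) by (simp add: F_def)
    ultimately show ?thesis unfolding M_def by blast
  qed
qed

section \<open>Error bounds and the effect of a scalar shift\<close>

context
  fixes c :: "nat \<Rightarrow> complex" and r :: complex
  assumes r: "r\<^sup>2 = \<theta>2"
    and c: "c 0 = 1" "c 1 = 0" "\<And>n. c (n + 2) = (\<Sum>p\<le>n. c p * c (n - p))"
begin

lemma sum_moment_limit:
  "\<exists>C\<ge>0. \<forall>I. finite I \<longrightarrow> I \<subseteq> {1..} \<longrightarrow>
    norm (sum_moment I n - r ^ n * c n * of_real (sqrt (card I)) ^ n) \<le> C * sqrt (card I) ^ (n - 1)"
proof -
  obtain C where C: "C \<ge> 0" "\<And>I. finite I \<Longrightarrow> I \<subseteq> {1..} \<Longrightarrow> sqrt (card I) *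
    norm (sum_moment I n - r ^ n * c n * of_real (sqrt (card I)) ^ n) \<le> C * sqrt (card I) ^ n"
    using sum_moment_asymptotic[OF r c, of n] by blast
  have "norm (sum_moment I n - r ^ n * c n * of_real (sqrt (card I)) ^ n) \<le> C * sqrt (card I) ^ (n - 1)"
    if I: "finite I" "I \<subseteq> {1..}" for I
  \<comment> \<open>In these cases the difference itself vanishes; otherwise the previous estimate
    is divided by \<open>sqrt (card I)\<close>.\<close>
  proof (cases "n = 0 \<or> I = {}")
    case True
    then show ?thesis using C(1) c by (cases "n = 0") (auto simp: sum_moment_empty power_0_left)
  next
    case False
    then have "sqrt (card I) > 0" using I by (simp add: card_gt_0_iff)
    moreover have "sqrt (card I) ^ n = sqrt (card I) * sqrt (card I) ^ (n - 1)"
      using False by (cases n) auto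
    ultimately show ?thesis using C(2)[OF I] by (simp add: mult.left_commute)
  qed
  with C(1) show ?thesis by blast
qed

lemma sum_moment_bound:
  "\<exists>C\<ge>0. \<forall>I. finite I \<longrightarrow> I \<subseteq> {1..} \<longrightarrow> norm (sum_moment I n) \<le> C * sqrt (card I) ^ n"
proof -
  obtain C where C: "C \<ge> 0" "\<And>I. finite I \<Longrightarrow> I \<subseteq> {1..} \<Longrightarrow>
      norm (sum_moment I n - r ^ n * c n * of_real (sqrt (card I)) ^ n) \<le> C * sqrt (card I) ^ (n - 1)"
    using sum_moment_limit[of n] by blast
  define D where "D = C + norm (r ^ n * c n) + 1"
  have "norm (sum_moment I n) \<le> D * sqrt (card I) ^ n" if I: "finite I" "I \<subseteq> {1..}" for I
  proof (cases "I = {}")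
    case True
    then show ?thesis using C(1) by (auto simp: sum_moment_empty D_def power_0_left)
  next
    case False
    then have "real (card I) \<ge> 1" using I by (simp add: Suc_leI card_gt_0_iff)
    then have x: "sqrt (card I) \<ge> 1" by simp
    have "norm (sum_moment I n) \<le> norm (r ^ n * c n * of_real (sqrt (card I)) ^ n)
        + norm (sum_moment I n - r ^ n * c n * of_real (sqrt (card I)) ^ n)"
      by (rule norm_triangle_sub)
    also have "\<dots> \<le> norm (r ^ n * c n) * sqrt (card I) ^ n + C * sqrt (card I) ^ (n - 1)"
      using C(2)[OF I] by (simp add: norm_mult norm_power)
    also have "\<dots> \<le> norm (r ^ n * c n) * sqrt (card I) ^ n + C * sqrt (card I) ^ n"
      using x C(1) by (intro add_left_mono mult_left_mono power_increasing) auto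
    also have "\<dots> \<le> D * sqrt (card I) ^ n"
      using x by (simp add: D_def algebra_simps)
    finally show ?thesis .
  qed
  moreover have "D \<ge> 0" using C(1) by (simp add: D_def)
  ultimately show ?thesis by blast
qed

text \<open>Converting the shifted factors into plain ones, one at a time, replaces a binomial
  expansion; the number \<open>j\<close> of converted factors therefore varies in the inductions on
  \<open>m\<close> below.\<close>

lemma T_shift_Suc:
  "T I ^ j * (T I + smul z 1) ^ Suc m
    = T I ^ Suc j * (T I + smul z 1) ^ m + smul z (T I ^ j * (T I + smul z 1) ^ m)"
  unfolding power_Suc[of "T I + smul z 1"] power_Suc2[of "T I" j]
  by (simp add: distrib_left distrib_right mult.assoc smul_mult_left smul_mult_right)

lemma shifted_moment_bound:
  "\<exists>C\<ge>0. \<forall>I z. finite I \<longrightarrow> I \<subseteq> {1..} \<longrightarrow>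
    norm (\<phi> (T I ^ j * (T I + smul z 1) ^ m)) \<le> C * (norm z + sqrt (card I)) ^ (j + m)"
proof (induction m arbitrary: j)
  case 0
  obtain C where C: "C \<ge> 0" "\<And>I. finite I \<Longrightarrow> I \<subseteq> {1..} \<Longrightarrow> norm (sum_moment I j) \<le> C * sqrt (card I) ^ j"
    using sum_moment_bound[of j] by blast
  have "norm (sum_moment I j) \<le> C * (norm z + sqrt (card I)) ^ j"
    if "finite I" "I \<subseteq> {1..}" for I and z :: complex
  proof -
    have "sqrt (card I) ^ j \<le> (norm z + sqrt (card I)) ^ j" by (intro power_mono) auto
    with C show ?thesis using that by (meson mult_left_mono order.trans)
  qed
  with C(1) show ?case by (auto simp flip: sum_moment_def)
next
  case (Suc m)
  obtain C where C: "C \<ge> 0" "\<And>I z. finite I \<Longrightarrow> I \<subseteq> {1..} \<Longrightarrow>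
      norm (\<phi> (T I ^ Suc j * (T I + smul z 1) ^ m)) \<le> C * (norm z + sqrt (card I)) ^ (Suc j + m)"
    using Suc[of "Suc j"] by blast
  obtain D where D: "D \<ge> 0" "\<And>I z. finite I \<Longrightarrow> I \<subseteq> {1..} \<Longrightarrow>
      norm (\<phi> (T I ^ j * (T I + smul z 1) ^ m)) \<le> D * (norm z + sqrt (card I)) ^ (j + m)"
    using Suc[of j] by blast
  have "norm (\<phi> (T I ^ j * (T I + smul z 1) ^ Suc m)) \<le> (C + D) * (norm z + sqrt (card I)) ^ (j + Suc m)"
    if I: "finite I" "I \<subseteq> {1..}" for I z
  proof -
    define y where "y = norm z + sqrt (card I)"
    have y: "y \<ge> 0" by (simp add: y_def)
    have "norm (\<phi> (T I ^ j * (T I + smul z 1) ^ Suc m))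
        \<le> norm (\<phi> (T I ^ Suc j * (T I + smul z 1) ^ m)) + norm z * norm (\<phi> (T I ^ j * (T I + smul z 1) ^ m))"
      unfolding T_shift_Suc \<phi>_add \<phi>_smul norm_mult[symmetric] by (rule norm_triangle_ineq)
    also have "\<dots> \<le> C * y ^ (Suc j + m) + y * (D * y ^ (j + m))"
      using C(2)[OF I] D(2)[OF I] y by (intro add_mono mult_mono) (auto simp: y_def)
    finally show ?thesis by (simp add: y_def algebra_simps)
  qed
  with C(1) D(1) show ?case by (intro exI[of _ "C + D"]) auto
qed

text \<open>Each conversion of a factor costs one explicit \<open>z\<close> times a moment
  controlled by \<open>shifted_moment_bound\<close>, so the total difference carries a factor
  \<open>norm z\<close>.\<close>

lemma shifted_moment_diff:
  "\<exists>C\<ge>0. \<forall>I z. finite I \<longrightarrow> I \<subseteq> {1..} \<longrightarrow>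
    norm (\<phi> (T I ^ j * (T I + smul z 1) ^ m) - sum_moment I (j + m))
      \<le> C * norm z * (norm z + sqrt (card I)) ^ (j + m - 1)"
proof (induction m arbitrary: j)
  case 0
  show ?case by (intro exI[of _ 0]) (simp add: sum_moment_def)
next
  case (Suc m)
  obtain C where C: "C \<ge> 0" "\<And>I z. finite I \<Longrightarrow> I \<subseteq> {1..} \<Longrightarrow>
      norm (\<phi> (T I ^ Suc j * (T I + smul z 1) ^ m) - sum_moment I (Suc j + m))
        \<le> C * norm z * (norm z + sqrt (card I)) ^ (j + m)"
    using Suc[of "Suc j"] by auto
  obtain D where D: "D \<ge> 0" "\<And>I z. finite I \<Longrightarrow> I \<subseteq> {1..} \<Longrightarrow>
      norm (\<phi> (T I ^ j * (T I + smul z 1) ^ m)) \<le> D * (norm z + sqrt (card I)) ^ (j + m)"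
    using shifted_moment_bound[of j m] by blast
  have "norm (\<phi> (T I ^ j * (T I + smul z 1) ^ Suc m) - sum_moment I (j + Suc m))
      \<le> (C + D) * norm z * (norm z + sqrt (card I)) ^ (j + Suc m - 1)"
    if I: "finite I" "I \<subseteq> {1..}" for I z
  proof -
    have "norm (\<phi> (T I ^ j * (T I + smul z 1) ^ Suc m) - sum_moment I (j + Suc m))
      \<le> norm (\<phi> (T I ^ Suc j * (T I + smul z 1) ^ m) - sum_moment I (Suc j + m))
        + norm z * norm (\<phi> (T I ^ j * (T I + smul z 1) ^ m))"
      unfolding T_shift_Suc \<phi>_add \<phi>_smul norm_mult[symmetric]
      using norm_triangle_ineq[of "\<phi> (T I ^ Suc j * (T I + smul z 1) ^ m) - sum_moment I (Suc j + m)"]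
      by (simp add: algebra_simps)
    also have "\<dots> \<le> C * norm z * (norm z + sqrt (card I)) ^ (j + m)
        + norm z * (D * (norm z + sqrt (card I)) ^ (j + m))"
      by (intro add_mono mult_left_mono C(2) D(2) I) auto
    finally show ?thesis by (simp add: algebra_simps)
  qed
  with C(1) D(1) show ?case by (intro exI[of _ "C + D"]) auto
qed

text \<open>The \<open>b i\<close> absorb the mean \<open>k * \<alpha>\<close>; centering at
  \<open>e * \<alpha>\<close> instead leaves a scalar shift proportional to
  \<open>k - e\<close>.\<close>

lemma partial_sum_centered:
  "partial_sum a k - smul (of_real e * \<alpha>) 1 = T {1..k} + smul (\<alpha> * of_real (real k - e)) 1"
proof -
  have "partial_sum a k = T {1..k} + smul (of_nat k * \<alpha>) 1"
  proof (induction k)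
    case (Suc k)
    then have "partial_sum a (Suc k) = T {1..k} + smul (of_nat k * \<alpha>) 1 + (b (Suc k) + smul \<alpha> 1)"
      by (simp add: partial_sum_def b_def)
    then show ?case by (simp add: T_def distrib_right scale_left_distrib add_ac)
  qed (simp add: partial_sum_def T_def)
  moreover have "smul (of_nat k * \<alpha>) 1
      = smul (\<alpha> * of_real (real k - e)) 1 + smul (of_real e * \<alpha>) (1 :: 'a)"
    unfolding scale_left_distrib[symmetric] by (simp add: algebra_simps)
  ultimately show ?thesis by simp
qed

text \<open>\<open>h\<close> stands for the square root of the expected number of summands. Three
  errors add up: the scalar shift, the Catalan limit, and the replacement of \<open>sqrt k\<close>
  by \<open>h\<close>. Each is bounded with the distance of \<open>k\<close> from
  \<open>h * h\<close>, plus 1, in the place of one power of \<open>h\<close>.\<close>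

lemma centered_sum_moment:
  assumes "m \<ge> 1"
  shows "\<exists>C\<ge>0. \<forall>k. \<forall>h\<ge>1.
    norm (\<phi> ((partial_sum a k - smul (of_real (h\<^sup>2) * \<alpha>) 1) ^ m) - r ^ m * c m * of_real h ^ m)
      \<le> C * ((\<bar>real k - h\<^sup>2\<bar> + 1) * (\<bar>real k - h\<^sup>2\<bar> + h) ^ (m - 1))"
proof -
  have upto: "finite {1..k}" "{1..k} \<subseteq> {1..}" "card {1..k} = k" for k :: nat by auto
  obtain C where C0: "C \<ge> 0" and C1: "\<And>I z. finite I \<Longrightarrow> I \<subseteq> {1..} \<Longrightarrow>
      norm (\<phi> (T I ^ 0 * (T I + smul z 1) ^ m) - sum_moment I (0 + m))
        \<le> C * norm z * (norm z + sqrt (card I)) ^ (0 + m - 1)"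
    using shifted_moment_diff[of 0 m] by blast
  have C: "C \<ge> 0" "norm (\<phi> ((T {1..k} + smul z 1) ^ m) - sum_moment {1..k} m)
      \<le> C * norm z * (norm z + sqrt (real k)) ^ (m - 1)" for k z
    using C0 C1[OF upto(1,2), of k z] by simp_all
  obtain D where D0: "D \<ge> 0" and D1: "\<And>I. finite I \<Longrightarrow> I \<subseteq> {1..} \<Longrightarrow>
      norm (sum_moment I m - r ^ m * c m * of_real (sqrt (card I)) ^ m) \<le> D * sqrt (card I) ^ (m - 1)"
    using sum_moment_limit[of m] by blast
  have D: "D \<ge> 0" "norm (sum_moment {1..k} m - r ^ m * c m * of_real (sqrt (real k)) ^ m)
      \<le> D * sqrt (real k) ^ (m - 1)" for k
    using D0 D1[OF upto(1,2), of k] by simp_all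
  define A where "A = norm \<alpha>"
  define K where "K = norm (r ^ m * c m)"
  define E where "E = C * A * (A + 1) ^ (m - 1) + D + K * m"
  have AK: "A \<ge> 0" "K \<ge> 0" by (simp_all add: A_def K_def)
  have "norm (\<phi> ((partial_sum a k - smul (of_real (h\<^sup>2) * \<alpha>) 1) ^ m) - r ^ m * c m * of_real h ^ m)
      \<le> E * ((\<bar>real k - h\<^sup>2\<bar> + 1) * (\<bar>real k - h\<^sup>2\<bar> + h) ^ (m - 1))"
    if h: "h \<ge> 1" for k h
  proof -
    define x d where "x = sqrt (real k)" and "d = \<bar>real k - h\<^sup>2\<bar>"
    have d0: "d \<ge> 0" and x0: "x \<ge> 0" by (simp_all add: d_def x_def)
    \<comment> \<open>Because \<open>x + h \<ge> 1\<close>, the roots differ by no more than their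
      squares.\<close>
    have "real k - h\<^sup>2 = (x - h) * (x + h)"
      by (simp add: x_def algebra_simps power2_eq_square)
    then have "d = \<bar>x - h\<bar> * (x + h)" using x0 h by (simp add: d_def abs_mult)
    moreover have "\<bar>x - h\<bar> * 1 \<le> \<bar>x - h\<bar> * (x + h)" using x0 h by (intro mult_left_mono) auto
    ultimately have xh: "\<bar>x - h\<bar> \<le> d" by simp
    then have xdh: "x \<le> d + h" by simp
    define z where "z = \<alpha> * of_real (real k - h\<^sup>2)"
    have nz: "norm z = A * d" by (simp add: z_def norm_mult A_def d_def del: of_real_diff)
    define Q where "Q = (d + h) ^ (m - 1)"
    have Q: "Q \<ge> 0" using d0 h by (simp add: Q_def)
    have 1: "norm (\<phi> ((T {1..k} + smul z 1) ^ m) - sum_moment {1..k} m) \<le> C * A * (A + 1) ^ (m - 1) * (d * Q)"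
    proof -
      have "C * norm z * (norm z + x) ^ (m - 1) \<le> C * norm z * ((A + 1) * (d + h)) ^ (m - 1)"
      proof (intro mult_left_mono power_mono)
        have "A * d \<le> A * (d + h)" using AK h by (intro mult_left_mono) auto
        then show "norm z + x \<le> (A + 1) * (d + h)" using xdh by (simp add: nz algebra_simps)
      qed (use C x0 in auto)
      then show ?thesis using C(2)[of k z] by (simp add: nz x_def Q_def power_mult_distrib mult_ac)
    qed
    have 2: "norm (sum_moment {1..k} m - r ^ m * c m * of_real x ^ m) \<le> D * Q"
    proof -
      have "D * x ^ (m - 1) \<le> D * Q"
        unfolding Q_def using x0 xdh D by (intro mult_left_mono power_mono) auto
      then show ?thesis using D(2)[of k] by (simp add: x_def)
    qed
    have 3: "norm (r ^ m * c m * of_real x ^ m - r ^ m * c m * of_real h ^ m) \<le> K * m * (d * Q)"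
    proof -
      have "norm (r ^ m * c m * of_real x ^ m - r ^ m * c m * of_real h ^ m) = K * \<bar>x ^ m - h ^ m\<bar>"
        unfolding right_diff_distrib[symmetric] of_real_power[symmetric] of_real_diff[symmetric]
        by (simp only: K_def norm_mult norm_of_real)
      also have "\<dots> \<le> K * (real m * \<bar>x - h\<bar> * Q)"
        unfolding Q_def using x0 xdh h d0 AK by (intro mult_left_mono abs_power_diff_le) auto
      also have "\<dots> \<le> K * (real m * d * Q)"
        using xh Q AK by (intro mult_left_mono mult_right_mono) auto
      finally show ?thesis by (simp add: mult_ac)
    qed
    have "norm (\<phi> ((T {1..k} + smul z 1) ^ m) - r ^ m * c m * of_real h ^ m)
        \<le> norm (\<phi> ((T {1..k} + smul z 1) ^ m) - sum_moment {1..k} m)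
          + norm (sum_moment {1..k} m - r ^ m * c m * of_real x ^ m)
          + norm (r ^ m * c m * of_real x ^ m - r ^ m * c m * of_real h ^ m)"
      by norm
    also have "\<dots> \<le> C * A * (A + 1) ^ (m - 1) * (d * Q) + D * Q + K * m * (d * Q)"
      using 1 2 3 by linarith
    also have "\<dots> \<le> C * A * (A + 1) ^ (m - 1) * ((d + 1) * Q) + D * ((d + 1) * Q) + K * m * ((d + 1) * Q)"
      using C D AK Q d0 by (intro add_mono mult_left_mono) (auto simp: algebra_simps)
    also have "\<dots> = E * ((d + 1) * Q)" by (simp add: E_def algebra_simps)
    finally show ?thesis by (simp only: partial_sum_centered z_def d_def Q_def)
  qed
  moreover have "E \<ge> 0" using C D AK by (simp add: E_def)
  ultimately show ?thesis by blast
qed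

end

end

section \<open>Expectations of almost constant functions\<close>

lemma add_power_le:
  fixes x y :: real
  assumes "x \<ge> 0" "y \<ge> 0"
  shows "(x + y) ^ n \<le> 2 ^ n * (x ^ n + y ^ n)"
proof -
  have "(x + y) ^ n \<le> (2 * max x y) ^ n" using assms by (intro power_mono) auto
  also have "\<dots> = 2 ^ n * max x y ^ n" by (simp add: power_mult_distrib)
  also have "max x y ^ n \<le> x ^ n + y ^ n" using assms by (auto simp: max_def)
  finally show ?thesis by simp
qed

text \<open>Expand the nonnegative integral of \<open>(A * Y - P * X)\<^sup>2\<close>; it is
  \<open>A\<close> times the asserted difference, and \<open>A > 0\<close> can be cancelled.\<close>

lemma integral_Cauchy_Schwarz:
  fixes X Y :: "'w \<Rightarrow> real"
  assumes XX: "integrable M (\<lambda>\<omega>. (X \<omega>)\<^sup>2)" and YY: "integrable M (\<lambda>\<omega>. (Y \<omega>)\<^sup>2)"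
    and XY: "integrable M (\<lambda>\<omega>. X \<omega> * Y \<omega>)" and pos: "(\<integral>\<omega>. (X \<omega>)\<^sup>2 \<partial>M) > 0"
  shows "(\<integral>\<omega>. X \<omega> * Y \<omega> \<partial>M)\<^sup>2 \<le> (\<integral>\<omega>. (X \<omega>)\<^sup>2 \<partial>M) * (\<integral>\<omega>. (Y \<omega>)\<^sup>2 \<partial>M)"
proof -
  define A B P where "A = (\<integral>\<omega>. (X \<omega>)\<^sup>2 \<partial>M)" and "B = (\<integral>\<omega>. (Y \<omega>)\<^sup>2 \<partial>M)"
    and "P = (\<integral>\<omega>. X \<omega> * Y \<omega> \<partial>M)"
  have "0 \<le> (\<integral>\<omega>. (A * Y \<omega> - P * X \<omega>)\<^sup>2 \<partial>M)" by simp
  also have "\<dots> = (\<integral>\<omega>. A\<^sup>2 * (Y \<omega>)\<^sup>2 + P\<^sup>2 * (X \<omega>)\<^sup>2 - 2 * A * P * (X \<omega> * Y \<omega>) \<partial>M)"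
    by (rule Bochner_Integration.integral_cong) (simp_all add: power2_eq_square algebra_simps)
  also have "\<dots> = A\<^sup>2 * B + P\<^sup>2 * A - 2 * A * P * P"
    using XX YY XY by (simp add: A_def B_def P_def)
  also have "\<dots> = A * (A * B - P\<^sup>2)" by (simp add: power2_eq_square algebra_simps)
  finally show ?thesis using pos
    by (simp add: zero_le_mult_iff flip: A_def B_def P_def) 
qed

text \<open>Cauchy-Schwarz separates the factor \<open>d + 1\<close>, whose second moment is
  governed by the variance when \<open>e\<close> is the mean, from the power of
  \<open>d + h\<close>, of which only the order of magnitude will matter.\<close>

lemma (in prob_space) expectation_polynomially_close:
  fixes N :: "'a \<Rightarrow> nat" and G :: "nat \<Rightarrow> complex" and e h C :: real and L :: complex
  assumes N [measurable]: "N \<in> measurable M (count_space UNIV)"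
    and moments: "\<And>m. integrable M (\<lambda>\<omega>. real (N \<omega>) ^ m)"
    and G: "\<And>k. norm (G k - L) \<le> C * ((\<bar>real k - e\<bar> + 1) * (\<bar>real k - e\<bar> + h) ^ q)"
    and h: "h \<ge> 1" and C: "C \<ge> 0"
  shows "(norm (expectation (\<lambda>\<omega>. G (N \<omega>)) - L))\<^sup>2 \<le> C\<^sup>2 * (4 * (expectation (\<lambda>\<omega>. \<bar>real (N \<omega>) - e\<bar> ^ 2) + 1)
    * (4 ^ q * (expectation (\<lambda>\<omega>. \<bar>real (N \<omega>) - e\<bar> ^ (2 * q)) + (h\<^sup>2) ^ q)))"
proof -
  define d where "d \<omega> = \<bar>real (N \<omega>) - e\<bar>" for \<omega>
  have d0: "d \<omega> \<ge> 0" for \<omega> by (simp add: d_def)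
  have [measurable]: "d \<in> borel_measurable M" unfolding d_def by measurable
  have GN [measurable]: "(\<lambda>\<omega>. G (N \<omega>)) \<in> borel_measurable M"
    by (rule measurable_compose[OF N]) simp
  have int_shift: "integrable M (\<lambda>\<omega>. (d \<omega> + s) ^ m)" if s: "s \<ge> 0" for s m
  proof (rule Bochner_Integration.integrable_bound)
    show "integrable M (\<lambda>\<omega>. 2 ^ m * (real (N \<omega>) ^ m + (\<bar>e\<bar> + s) ^ m))"
      using moments by simp
    show "AE \<omega> in M. norm ((d \<omega> + s) ^ m) \<le> norm (2 ^ m * (real (N \<omega>) ^ m + (\<bar>e\<bar> + s) ^ m))"
    proof (rule AE_I2)
      fix \<omega>
      have "(d \<omega> + s) ^ m \<le> (real (N \<omega>) + (\<bar>e\<bar> + s)) ^ m"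
        using s by (intro power_mono) (auto simp: d_def)
      also have "\<dots> \<le> 2 ^ m * (real (N \<omega>) ^ m + (\<bar>e\<bar> + s) ^ m)"
        using s by (intro add_power_le) auto
      finally show "norm ((d \<omega> + s) ^ m) \<le> norm (2 ^ m * (real (N \<omega>) ^ m + (\<bar>e\<bar> + s) ^ m))"
        using s d0[of \<omega>] by simp
    qed
  qed measurable
  have int_d: "integrable M (\<lambda>\<omega>. d \<omega> ^ m)" for m using int_shift[of 0 m] by simp
  define X Y where "X \<omega> = d \<omega> + 1" and "Y \<omega> = (d \<omega> + h) ^ q" for \<omega>
  have XX: "integrable M (\<lambda>\<omega>. (X \<omega>)\<^sup>2)" and YY: "integrable M (\<lambda>\<omega>. (Y \<omega>)\<^sup>2)"
    unfolding X_def Y_def power_mult[symmetric] using h by (auto intro!: int_shift)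
  have XY: "integrable M (\<lambda>\<omega>. X \<omega> * Y \<omega>)"
  proof (rule Bochner_Integration.integrable_bound)
    show "integrable M (\<lambda>\<omega>. (d \<omega> + h) ^ Suc q)" using h by (intro int_shift) simp
    show "AE \<omega> in M. norm (X \<omega> * Y \<omega>) \<le> norm ((d \<omega> + h) ^ Suc q)"
      using h d0 by (intro AE_I2) (simp add: X_def Y_def abs_mult mult_right_mono)
  qed (simp add: X_def Y_def)
  \<comment> \<open>This supplies the positive second moment that
    \<open>integral_Cauchy_Schwarz\<close> requires.\<close>
  have X1: "(X \<omega>)\<^sup>2 \<ge> 1" for \<omega>
    unfolding X_def using d0[of \<omega>] by (intro one_le_power) simp
  have "expectation (\<lambda>\<omega>. 1) \<le> expectation (\<lambda>\<omega>. (X \<omega>)\<^sup>2)"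
    by (intro integral_mono XX X1) simp
  then have X_pos: "expectation (\<lambda>\<omega>. (X \<omega>)\<^sup>2) > 0" by (simp add: prob_space)
  have G_bound: "norm (G (N \<omega>) - L) \<le> C * (X \<omega> * Y \<omega>)" for \<omega>
    using G[of "N \<omega>"] by (simp add: X_def Y_def d_def)
  have int_diff: "integrable M (\<lambda>\<omega>. G (N \<omega>) - L)"
    by (rule Bochner_Integration.integrable_bound[OF integrable_mult_right[OF XY, of C]])
      (use G_bound in \<open>auto intro: order.trans[OF _ abs_ge_self]\<close>)
  have int_G: "integrable M (\<lambda>\<omega>. G (N \<omega>))"
    using Bochner_Integration.integrable_add[OF int_diff, of "\<lambda>_. L"] by simp
  have "norm (expectation (\<lambda>\<omega>. G (N \<omega>)) - L) = norm (expectation (\<lambda>\<omega>. G (N \<omega>) - L))"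
    using int_G by (simp add: prob_space)
  also have "\<dots> \<le> expectation (\<lambda>\<omega>. C * (X \<omega> * Y \<omega>))"
    using G_bound XY int_diff
    by (intro order.trans[OF integral_norm_bound] integral_mono) auto
  also have "\<dots> = C * expectation (\<lambda>\<omega>. X \<omega> * Y \<omega>)" by simp
  finally have "(norm (expectation (\<lambda>\<omega>. G (N \<omega>)) - L))\<^sup>2 \<le> (C * expectation (\<lambda>\<omega>. X \<omega> * Y \<omega>))\<^sup>2"
    by (intro power_mono) auto
  also have "\<dots> \<le> C\<^sup>2 * (expectation (\<lambda>\<omega>. (X \<omega>)\<^sup>2) * expectation (\<lambda>\<omega>. (Y \<omega>)\<^sup>2))"
    unfolding power_mult_distrib
    by (intro mult_left_mono integral_Cauchy_Schwarz XX YY XY X_pos) simp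
  also have "\<dots> \<le> C\<^sup>2 * (4 * (expectation (\<lambda>\<omega>. d \<omega> ^ 2) + 1)
    * (4 ^ q * (expectation (\<lambda>\<omega>. d \<omega> ^ (2 * q)) + (h\<^sup>2) ^ q)))"
  proof (intro mult_left_mono mult_mono)
    have "expectation (\<lambda>\<omega>. (X \<omega>)\<^sup>2) \<le> expectation (\<lambda>\<omega>. 4 * (d \<omega> ^ 2 + 1))"
    proof (rule integral_mono[OF XX])
      show "integrable M (\<lambda>\<omega>. 4 * (d \<omega> ^ 2 + 1))" using int_d[of 2] by simp
      show "(X \<omega>)\<^sup>2 \<le> 4 * (d \<omega> ^ 2 + 1)" for \<omega>
        using add_power_le[OF d0, of 1 \<omega> 2] by (simp add: X_def)
    qed
    then show "expectation (\<lambda>\<omega>. (X \<omega>)\<^sup>2) \<le> 4 * (expectation (\<lambda>\<omega>. d \<omega> ^ 2) + 1)"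
      using int_d[of 2] by (simp add: prob_space)
    have "expectation (\<lambda>\<omega>. (Y \<omega>)\<^sup>2) \<le> expectation (\<lambda>\<omega>. 4 ^ q * (d \<omega> ^ (2 * q) + (h\<^sup>2) ^ q))"
    proof (rule integral_mono[OF YY])
      show "integrable M (\<lambda>\<omega>. 4 ^ q * (d \<omega> ^ (2 * q) + (h\<^sup>2) ^ q))" using int_d[of "2 * q"] by simp
      have "(4::real) ^ q = 2 ^ (2 * q)" by (simp add: power_mult)
      then show "(Y \<omega>)\<^sup>2 \<le> 4 ^ q * (d \<omega> ^ (2 * q) + (h\<^sup>2) ^ q)" for \<omega>
        using add_power_le[OF d0, of h \<omega> "2 * q"] h
        by (simp add: Y_def mult.commute[of q] flip: power_mult)
    qed
    then show "expectation (\<lambda>\<omega>. (Y \<omega>)\<^sup>2) \<le> 4 ^ q * (expectation (\<lambda>\<omega>. d \<omega> ^ (2 * q)) + (h\<^sup>2) ^ q)"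
      using int_d[of "2 * q"] by (simp add: prob_space)
  qed (use d0 in auto)
  finally show ?thesis by (simp add: d_def)
qed

section \<open>The semicircle law and the method of moments\<close>

definition semicircle :: "real measure" where
  "semicircle = density lborel (\<lambda>t. ennreal (semicircle_density t))"

lemma semicircle_density_measurable [measurable]: "semicircle_density \<in> borel_measurable borel"
  unfolding semicircle_density_def by measurable

lemma semicircle_density_nonneg: "semicircle_density t \<ge> 0"
  using abs_le_square_iff[of t 2] by (auto simp: semicircle_density_def abs_le_iff)

definition sc_moment :: "nat \<Rightarrow> real" where
  "sc_moment n = (\<integral>t. t ^ n \<partial>semicircle)"

lemma sc_moment_eq:
  "sc_moment n = integral {-2..2} (\<lambda>t. t ^ n * sqrt (4 - t\<^sup>2)) / (2 * pi)"
proof -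
  have "sc_moment n = (LINT t:{-2..2}|lborel. t ^ n * sqrt (4 - t\<^sup>2) / (2 * pi))"
    unfolding sc_moment_def semicircle_def set_lebesgue_integral_def
    by (subst integral_real_density)
      (simp_all add: semicircle_density_nonneg,
       auto simp: semicircle_density_def indicator_def simp flip: integral_divide_zero
         intro!: Bochner_Integration.integral_cong)
  also have "\<dots> = integral {-2..2} (\<lambda>t. t ^ n * sqrt (4 - t\<^sup>2) / (2 * pi))"
    by (intro set_borel_integral_eq_integral borel_integrable_atLeastAtMost' continuous_intros) auto
  finally show ?thesis by simp
qed

text \<open>The integrand is the derivative of \<open>t ^ n\<close> times the power 3/2 of
  \<open>4 - t\<^sup>2\<close>, which vanishes at both endpoints. For \<open>n = 0\<close> the
  factor \<open>real n\<close> removes the truncated power.\<close>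

lemma integral_semicircle_parts:
  "integral {-2..2} (\<lambda>t. (real n * t ^ (n - 1) * (4 - t\<^sup>2) - 3 * t ^ (n + 1)) * sqrt (4 - t\<^sup>2)) = (0::real)"
proof -
  have "((\<lambda>t. (real n * t ^ (n - 1) * (4 - t\<^sup>2) - 3 * t ^ (n + 1)) * sqrt (4 - t\<^sup>2)) has_integral
    (\<lambda>t::real. t ^ n * ((4 - t\<^sup>2) * sqrt (4 - t\<^sup>2))) 2 - (\<lambda>t::real. t ^ n * ((4 - t\<^sup>2) * sqrt (4 - t\<^sup>2))) (-2)) {-2..2}"
  \<comment> \<open>The square root is not differentiable at the endpoints, so derivatives are taken
    in the interior and only continuity is used on the closed interval.\<close>
  proof (rule fundamental_theorem_of_calculus_interior)
    fix t :: real assume "t \<in> {-2<..<2}"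
    then have "\<bar>t\<bar> < 2" by auto
    then have pos: "4 - t\<^sup>2 > 0" using abs_square_less_1[of "t / 2"] by (simp add: power_divide)
    have "((\<lambda>t. t ^ n * ((4 - t\<^sup>2) * sqrt (4 - t\<^sup>2))) has_real_derivative
      real n * t ^ (n - 1) * ((4 - t\<^sup>2) * sqrt (4 - t\<^sup>2)) +
      t ^ n * (- (2 * t) * sqrt (4 - t\<^sup>2) + (4 - t\<^sup>2) * (- t / sqrt (4 - t\<^sup>2)))) (at t)"
      using pos by (auto intro!: derivative_eq_intros simp: field_simps)
    also have "(4 - t\<^sup>2) * (- t / sqrt (4 - t\<^sup>2)) = - t * sqrt (4 - t\<^sup>2)"
      using pos by (simp add: field_simps)
    finally show "((\<lambda>t. t ^ n * ((4 - t\<^sup>2) * sqrt (4 - t\<^sup>2))) has_vector_derivative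
      (real n * t ^ (n - 1) * (4 - t\<^sup>2) - 3 * t ^ (n + 1)) * sqrt (4 - t\<^sup>2)) (at t)"
      by (simp add: has_real_derivative_iff_has_vector_derivative[symmetric] algebra_simps)
  qed (auto intro!: continuous_intros)
  then show ?thesis by (simp add: integral_unique)
qed

lemma sc_moment_1: "sc_moment 1 = 0"
proof -
  have "integral {-2..2} (\<lambda>t::real. -3 * (t ^ 1 * sqrt (4 - t\<^sup>2))) = 0"
    using integral_semicircle_parts[of 0] by (simp add: mult_ac)
  then show ?thesis unfolding sc_moment_eq integral_mult_right by simp
qed

text \<open>Integration by parts with \<open>n + 1\<close> for \<open>n\<close> has the polynomial
  factor \<open>4 * (n + 1) * t ^ n - (n + 4) * t ^ (n + 2)\<close>.\<close>

lemma sc_moment_rec: "(real n + 4) * sc_moment (n + 2) = 4 * (real n + 1) * sc_moment n"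
proof -
  have "integral {-2..2} (\<lambda>t::real. 4 * (real n + 1) * (t ^ n * sqrt (4 - t\<^sup>2))
      - (real n + 4) * (t ^ (n + 2) * sqrt (4 - t\<^sup>2))) = 0"
    by (rule trans[OF _ integral_semicircle_parts[of "n + 1"]])
      (simp add: algebra_simps power2_eq_square)
  moreover have "(\<lambda>t::real. c * (t ^ n * sqrt (4 - t\<^sup>2))) integrable_on {-2..2}" for c n
    by (intro integrable_continuous_interval continuous_intros)
  ultimately show ?thesis
    unfolding sc_moment_eq
    by (subst (asm) integral_diff) (simp_all only: integral_mult_right, simp add: field_simps)
qed

text \<open>The reflection of \<open>i\<close> to \<open>n - i\<close> preserves the product, so the
  weight \<open>i\<close> may be replaced by the average n/2.\<close>

lemma sum_index_convolution:
  fixes c :: "nat \<Rightarrow> real"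
  shows "(\<Sum>i\<le>n. real i * (c i * c (n - i))) = real n / 2 * (\<Sum>i\<le>n. c i * c (n - i))"
proof -
  have "(\<Sum>i\<le>n. real i * (c i * c (n - i))) = (\<Sum>i\<le>n. real (n - i) * (c i * c (n - i)))"
    by (intro sum.reindex_bij_witness[of _ "\<lambda>i. n - i" "\<lambda>i. n - i"]) auto
  then have "2 * (\<Sum>i\<le>n. real i * (c i * c (n - i)))
      = (\<Sum>i\<le>n. real i * (c i * c (n - i)) + real (n - i) * (c i * c (n - i)))"
    by (simp add: sum.distrib)
  also have "\<dots> = (\<Sum>i\<le>n. real n * (c i * c (n - i)))"
    by (rule sum.cong) (auto simp: of_nat_diff algebra_simps)
  finally show ?thesis unfolding sum_distrib_left[symmetric] by simp
qed

text \<open>The Catalan recursion follows without a closed formula: the linear recursion expresses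
  \<open>S (n + 2)\<close> through \<open>S n\<close> and \<open>c (n + 2)\<close>, which agree by
  induction.\<close>

lemma convolution_of_linear_recursion:
  fixes c :: "nat \<Rightarrow> real"
  assumes c: "c 0 = 1" "c 1 = 0" "\<And>n. (real n + 4) * c (n + 2) = 4 * (real n + 1) * c n"
  shows "c (n + 2) = (\<Sum>i\<le>n. c i * c (n - i))"
proof -
  define S where "S n = (\<Sum>i\<le>n. c i * c (n - i))" for n
  have S: "(\<Sum>i\<le>n. real i * (c i * c (n - i))) = real n / 2 * S n" for n
    unfolding S_def by (rule sum_index_convolution)
  have "S n = c (n + 2)"
  proof (induction n rule: induct_nat_012)
    case 0
    show ?case using c(3)[of 0] c(1) by (simp add: S_def)
  next
    case 1
    show ?case using c(3)[of 1] c(2) by (simp add: S_def)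
  next
    case (ge2 n)
    \<comment> \<open>After the shift by two the weight \<open>i + 2\<close> becomes
      \<open>i + 4\<close>, the factor that \<open>c (i + 2)\<close> carries in the linear
      recursion, while symmetry makes the weighted sum a multiple of
      \<open>S (n + 2)\<close>.\<close>
    have "(real n + 6) / 2 * S (n + 2) = (\<Sum>i\<le>n+2. (real i + 2) * (c i * c (n + 2 - i)))"
      using S[of "n + 2"] by (simp only: distrib_right sum.distrib sum_distrib_left[symmetric] mult.assoc)
        (simp add: S_def[symmetric] field_simps)
    also have "\<dots> = 2 * c (n + 2) + (\<Sum>i\<le>n. (real i + 4) * c (i + 2) * c (n - i))"
      using c(1,2) by (simp add: sum.atMost_Suc_shift mult_ac add_ac numeral_2_eq_2 del: sum.atMost_Suc)
    also have "(\<Sum>i\<le>n. (real i + 4) * c (i + 2) * c (n - i))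
        = (\<Sum>i\<le>n. 4 * (real i * (c i * c (n - i))) + 4 * (c i * c (n - i)))"
      by (rule sum.cong[OF refl], subst c(3)) (simp add: algebra_simps)
    also have "\<dots> = (2 * real n + 4) * S n"
      by (simp only: sum.distrib S sum_distrib_left[symmetric]) (simp add: S_def[symmetric] algebra_simps)
    finally have "(real n + 6) / 2 * S (n + 2) = (2 * real n + 6) * c (n + 2)"
      using ge2 by (simp add: algebra_simps)
    moreover have "(real n + 6) * c (n + 2 + 2) = 4 * (real n + 3) * c (n + 2)"
      using c(3)[of "n + 2"] by (simp add: algebra_simps)
    ultimately have "(real n + 6) * S (n + 2) = (real n + 6) * c (n + 2 + 2)" by (simp add: algebra_simps)
    then show ?case by (simp add: add_ac)
  qed
  then show ?thesis by (simp add: S_def)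
qed

text \<open>The ratio \<open>4 * (n + 1) / (n + 4)\<close> is at most 4 for each step of two. The
  base 2 is the radius of the support of the semicircle law.\<close>

lemma abs_le_of_linear_recursion:
  fixes c :: "nat \<Rightarrow> real"
  assumes c: "c 0 = 1" "c 1 = 0" "\<And>n. (real n + 4) * c (n + 2) = 4 * (real n + 1) * c n"
  shows "\<bar>c n\<bar> \<le> 2 ^ n"
proof (induction n rule: induct_nat_012)
  case (ge2 n)
  have "(real n + 4) * \<bar>c (n + 2)\<bar> = 4 * (real n + 1) * \<bar>c n\<bar>"
    using arg_cong[OF c(3)[of n], of abs] by (simp add: abs_mult)
  also have "\<dots> \<le> (real n + 4) * (4 * \<bar>c n\<bar>)" by (simp add: algebra_simps)
  finally have "\<bar>c (n + 2)\<bar> \<le> 4 * \<bar>c n\<bar>" by simp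
  with ge2 show ?case by simp
qed (use c in auto)

section \<open>The method of moments\<close>

lemma exp_tail_null: "(\<lambda>K. 2 * \<bar>x\<bar> ^ K / fact K) \<longlonglongrightarrow> (0::real)"
  using tendsto_mult_right_zero[OF summable_LIMSEQ_zero[OF summable_exp[of "\<bar>x\<bar>"]], of 2]
  by (simp add: field_simps)

text \<open>
  The characteristic functions are compared through their Taylor polynomials, whose remainders are
  uniformly small since \<open>\<mu>\<close> has moments of at most exponential growth.
\<close>

lemma weak_conv_of_moments:
  fixes M :: "nat \<Rightarrow> real measure" and \<mu> :: "real measure"
  assumes M: "\<And>n. real_distribution (M n)" "\<And>n m. integrable (M n) (\<lambda>t. t ^ m)"
    and \<mu>: "real_distribution \<mu>" "\<And>m. integrable \<mu> (\<lambda>t. t ^ m)"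
    and bound: "\<And>m. \<bar>\<integral>t. t ^ m \<partial>\<mu>\<bar> \<le> R ^ m"
    and conv: "\<And>m. (\<lambda>n. \<integral>t. t ^ m \<partial>M n) \<longlonglongrightarrow> (\<integral>t. t ^ m \<partial>\<mu>)"
  shows "weak_conv_m M \<mu>"
proof (rule levy_continuity[OF M(1) \<mu>(1)])
  fix t :: real
  define P where "P \<nu> K = (\<Sum>k\<le>K. ((\<i> * t) ^ k / fact k) * complex_of_real (\<integral>x. x ^ k \<partial>\<nu>))" for \<nu> K
  \<comment> \<open>An even order turns the absolute moment in the Taylor remainder into an ordinary
    one, whose convergence is assumed.\<close>
  have approx: "norm (char \<nu> t - P \<nu> (2 * K)) \<le> 2 * \<bar>t\<bar> ^ (2 * K) / fact (2 * K) * (\<integral>x. x ^ (2 * K) \<partial>\<nu>)"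
    if "real_distribution \<nu>" "\<And>m. integrable \<nu> (\<lambda>t. t ^ m)" for \<nu> K
    using real_distribution.char_approx1[OF that(1), of "2 * K" t] that(2)
    by (simp add: P_def power_even_abs)
  show "(\<lambda>n. char (M n) t) \<longlonglongrightarrow> char \<mu> t"
  proof (rule LIMSEQ_I)
    fix e :: real assume "e > 0"
    have "(\<lambda>K. 2 * \<bar>t * R\<bar> ^ (2 * K) / fact (2 * K)) \<longlonglongrightarrow> 0"
      by (rule filterlim_compose[OF exp_tail_null]) (simp add: filterlim_subseq strict_mono_def)
    \<comment> \<open>\<open>K\<close> is chosen through \<mu> alone; convergence of the moments of
      order \<open>2 * K\<close> carries the remainder bound over to all but finitely many
      \<open>M n\<close>.\<close>
    then obtain K where K: "2 * \<bar>t * R\<bar> ^ (2 * K) / fact (2 * K) < e / 4"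
      using \<open>e > 0\<close> by (metis (no_types, lifting) eventually_sequentially le_refl order_tendstoD(2)
          divide_pos_pos zero_less_numeral)
    let ?w = "\<lambda>\<nu>. 2 * \<bar>t\<bar> ^ (2 * K) / fact (2 * K) * (\<integral>x. x ^ (2 * K) \<partial>\<nu>)"
    have w\<mu>: "?w \<mu> < e / 4"
    proof -
      have "?w \<mu> \<le> 2 * \<bar>t\<bar> ^ (2 * K) / fact (2 * K) * R ^ (2 * K)"
        using bound[of "2 * K"] by (intro mult_left_mono) auto
      also have "\<dots> = 2 * \<bar>t * R\<bar> ^ (2 * K) / fact (2 * K)"
        by (simp add: abs_mult power_mult_distrib power_even_abs)
      finally show ?thesis using K by simp
    qed
    have "(\<lambda>n. ?w (M n)) \<longlonglongrightarrow> ?w \<mu>" by (intro tendsto_intros conv)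
    then have 1: "eventually (\<lambda>n. ?w (M n) < e / 4) sequentially"
      using w\<mu> by (rule order_tendstoD(2))
    have "(\<lambda>n. P (M n) (2 * K)) \<longlonglongrightarrow> P \<mu> (2 * K)"
      unfolding P_def by (intro tendsto_intros conv)
    then have 2: "eventually (\<lambda>n. dist (P (M n) (2 * K)) (P \<mu> (2 * K)) < e / 4) sequentially"
      by (rule tendstoD) (use \<open>e > 0\<close> in simp)
    have "eventually (\<lambda>n. norm (char (M n) t - char \<mu> t) < e) sequentially"
      using 1 2
    proof eventually_elim
      case (elim n)
      have "norm (char (M n) t - char \<mu> t) \<le> norm (char (M n) t - P (M n) (2 * K))
        + dist (P (M n) (2 * K)) (P \<mu> (2 * K)) + norm (char \<mu> t - P \<mu> (2 * K))"
        unfolding dist_norm by norm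
      with approx[OF M, of n K] approx[OF \<mu>, of K] elim w\<mu> show ?case using \<open>e > 0\<close> by linarith
    qed
    then show "\<exists>no. \<forall>n\<ge>no. norm (char (M n) t - char \<mu> t) < e"
      by (simp add: eventually_sequentially)
  qed
qed

section \<open>Random sums\<close>

text \<open>Odd moments would be sensitive to the choice of the roots \<open>r\<close> and
  \<open>\<sigma> n\<close>; their vanishing removes this dependence.\<close>

lemma odd_moment_of_linear_recursion:
  fixes c :: "nat \<Rightarrow> real"
  assumes c: "c 1 = 0" "\<And>n. (real n + 4) * c (n + 2) = 4 * (real n + 1) * c n"
  shows "odd n \<Longrightarrow> c n = 0"
proof (induction n rule: induct_nat_012)
  case (ge2 n)
  then show ?case using c(2)[of n] by simp
qed (use c in auto)

lemma (in complex_star_algebra) smul_power: "smul z x ^ m = smul (z ^ m) (x ^ m)"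
  by (induction m) (simp_all add: smul_mult_left smul_mult_right mult.commute)

lemma power_fun_apply: "(F ^ m) x = (F x :: 'b::monoid_mult) ^ m"
  by (induction m) simp_all

theorem corollary4p2:
  fixes smul :: "complex \<Rightarrow> 'a::ring_1 \<Rightarrow> 'a" and star :: "'a \<Rightarrow> 'a" and \<phi> :: "'a \<Rightarrow> complex"
    and a :: "nat \<Rightarrow> 'a"
    and M :: "'w measure" and N :: "nat \<Rightarrow> 'w \<Rightarrow> nat"
    and \<alpha> \<theta>2 :: complex and \<eta> \<gamma>2 :: "nat \<Rightarrow> real" and \<sigma>2 \<sigma> :: "nat \<Rightarrow> complex"
    and S :: "nat \<Rightarrow> 'w \<Rightarrow> 'a"
    and smul' :: "complex \<Rightarrow> 'b::ring_1 \<Rightarrow> 'b" and star' :: "'b \<Rightarrow> 'b" and \<psi> :: "'b \<Rightarrow> complex"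
    and s :: 'b and \<mu>\<^sub>s :: "real measure"
  assumes space: "nc_prob_space smul star \<phi>"
    and self_adjoint: "\<And>i. i \<ge> 1 \<Longrightarrow> star (a i) = a i"
    and free: "freely_independent smul \<phi> {1..} a"
    and identically_distributed: "\<And>i m. i \<ge> 1 \<Longrightarrow> \<phi> (a i ^ m) = \<phi> (a 1 ^ m)"
    and alpha: "\<alpha> = \<phi> (a 1)"
    and alpha_nonzero: "\<alpha> \<noteq> 0"
    and theta: "\<theta>2 = \<phi> ((a 1)\<^sup>2) - \<alpha>\<^sup>2"
    and theta_nonzero: "\<theta>2 \<noteq> 0"
    and prob: "prob_space M"
    and random_variable: "\<And>n. n \<ge> 1 \<Longrightarrow> N n \<in> measurable M (count_space UNIV)"
    and moments_finite: "\<And>n m. n \<ge> 1 \<Longrightarrow> integrable M (\<lambda>\<omega>. real (N n \<omega>) ^ m)"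
    and eta: "\<And>n. \<eta> n = prob_space.expectation M (\<lambda>\<omega>. real (N n \<omega>))"
    and gamma: "\<And>n. \<gamma>2 n = prob_space.variance M (\<lambda>\<omega>. real (N n \<omega>))"
    and sigma2: "\<And>n. \<sigma>2 n = of_real (\<eta> n) * \<theta>2 + of_real (\<gamma>2 n) * \<alpha>\<^sup>2"
    and sigma: "\<And>n. \<sigma> n = csqrt (\<sigma>2 n)"
    and S: "\<And>n \<omega>. S n \<omega> =
      smul (1 / \<sigma> n) (partial_sum a (N n \<omega>) - smul (of_real (\<eta> n) * \<alpha>) 1)"
    and eta_limit: "filterlim \<eta> at_top sequentially"
    and sigma2_limit: "filterlim \<sigma>2 at_infinity sequentially"
    and central_moments: "\<And>m. (\<lambda>n. prob_space.expectation M (\<lambda>\<omega>. \<bar>real (N n \<omega>) - \<eta> n\<bar> ^ m))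
      \<in> O(\<lambda>n. norm (\<sigma> n) ^ m)"
    and gamma_small: "\<gamma>2 \<in> o(\<eta>)"
    and space': "nc_prob_space smul' star' \<psi>"
    and semicircle: "standard_semicircle_variable star' \<psi> s"
    and mu_s: "is_probability_measure_of \<psi> s \<mu>\<^sub>s"
  shows "converges_star (\<lambda>_. expected_state M \<phi>) S \<psi> s \<and>
    (\<forall>\<mu>. (\<forall>n\<ge>1. is_probability_measure_of (expected_state M \<phi>) (S n) (\<mu> n)) \<longrightarrow>
      weak_conv_m \<mu> \<mu>\<^sub>s)"
proof -
  interpret free_identical smul star \<phi> a
    rewrites "free_identical.\<alpha> \<phi> a \<equiv> \<alpha>" and "free_identical.\<theta>2 \<phi> a \<equiv> \<theta>2"
  proof -
    interpret nc_prob_space smul star \<phi> by (rule space)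
    show *: "free_identical smul star \<phi> a"
      by unfold_locales (fact free, fact identically_distributed)
    show "free_identical.\<alpha> \<phi> a \<equiv> \<alpha>"
      by (simp add: free_identical.\<alpha>_def[OF *] alpha)
    then show "free_identical.\<theta>2 \<phi> a \<equiv> \<theta>2"
      by (simp add: free_identical.\<theta>2_def[OF *] theta)
  qed
  interpret prob_space M by (rule prob)
  have sc: "is_probability_measure_of \<psi> s semicircle"
    using semicircle by (simp add: standard_semicircle_variable_def semicircle_def)
  then interpret sc: real_distribution semicircle by (simp add: is_probability_measure_of_def)
  have sc_integrable: "integrable semicircle (\<lambda>t. t ^ m)"
    and sc_moments: "\<psi> (s ^ m) = of_real (sc_moment m)" for m
    using sc by (simp_all add: is_probability_measure_of_def same_moments_def sc_moment_def)
  \<comment> \<open>Both measures have the moments of \<open>s\<close>, and uniqueness is part of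
    being the probability measure of \<open>s\<close>.\<close>
  have mu_s_eq: "\<mu>\<^sub>s = semicircle"
    using sc mu_s unfolding is_probability_measure_of_def by blast
  have sc0: "sc_moment 0 = 1" using sc.prob_space by (simp add: sc_moment_def)
  note sc_rec = sc0 sc_moment_1 sc_moment_rec
  define c :: "nat \<Rightarrow> complex" where "c n = of_real (sc_moment n)" for n
  have c: "c 0 = 1" "c 1 = 0" "c (n + 2) = (\<Sum>p\<le>n. c p * c (n - p))" for n
    using sc_rec(1,2) convolution_of_linear_recursion[OF sc_rec, of n] by (simp_all add: c_def)
  define r where "r = csqrt \<theta>2"
  have r: "r\<^sup>2 = \<theta>2" by (simp add: r_def)
  have \<sigma>_sq: "(\<sigma> n)\<^sup>2 = \<sigma>2 n" for n by (simp add: sigma)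
  have norm_\<sigma>: "norm (\<sigma> n) ^ (2 * p) = norm (\<sigma>2 n) ^ p" for n p
    by (simp add: power_mult flip: norm_power \<sigma>_sq)

  have \<eta>_pos: "eventually (\<lambda>n. \<eta> n \<ge> 1) sequentially"
    using eta_limit by (simp add: filterlim_at_top)
  have inv_\<eta>: "(\<lambda>n. 1 / \<eta> n) \<longlonglongrightarrow> 0"
    using tendsto_inverse_0_at_top[OF eta_limit] by (simp add: inverse_eq_divide)
  have \<gamma>_\<eta>: "(\<lambda>n. \<gamma>2 n / \<eta> n) \<longlonglongrightarrow> 0" by (rule smalloD_tendsto[OF gamma_small])
  \<comment> \<open>Dividing \<open>\<sigma>2\<close> by \<open>\<eta>\<close> makes the variance
    part vanish, so \<open>\<sigma>2\<close> is asymptotic to \<open>\<theta>2 * \<eta>\<close>. As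
    \<open>\<theta>2\<close> is nonzero, \<open>\<sigma>2\<close> has exactly the order of
    \<open>\<eta>\<close> and is eventually nonzero.\<close>
  have "(\<lambda>n. \<theta>2 + of_real (\<gamma>2 n / \<eta> n) * \<alpha>\<^sup>2) \<longlonglongrightarrow> \<theta>2 + of_real 0 * \<alpha>\<^sup>2"
    by (intro tendsto_intros \<gamma>_\<eta>)
  moreover have "eventually (\<lambda>n. \<theta>2 + of_real (\<gamma>2 n / \<eta> n) * \<alpha>\<^sup>2 = \<sigma>2 n / of_real (\<eta> n)) sequentially"
    using \<eta>_pos by eventually_elim (simp add: sigma2 field_simps)
  ultimately have \<sigma>_\<eta>: "(\<lambda>n. \<sigma>2 n / of_real (\<eta> n)) \<longlonglongrightarrow> \<theta>2"
    by (auto dest: Lim_transform_eventually)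
  then have \<eta>_\<sigma>: "(\<lambda>n. of_real (\<eta> n) / \<sigma>2 n) \<longlonglongrightarrow> 1 / \<theta>2"
    using tendsto_inverse[OF \<sigma>_\<eta> theta_nonzero] by (simp add: inverse_eq_divide)
  have \<sigma>_nonzero: "eventually (\<lambda>n. \<sigma>2 n \<noteq> 0) sequentially"
    using tendsto_imp_eventually_ne[OF \<sigma>_\<eta> theta_nonzero] by eventually_elim auto
  have \<eta>_\<sigma>_norm: "(\<lambda>n. \<eta> n / norm (\<sigma>2 n)) \<longlonglongrightarrow> norm (1 / \<theta>2)"
    by (rule Lim_transform_eventually[OF tendsto_norm[OF \<eta>_\<sigma>]])
      (use \<eta>_pos in \<open>eventually_elim, simp add: norm_divide\<close>)
  \<comment> \<open>This null sequence is the only source of smallness in the error bound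
    \<open>B\<close> below.\<close>
  have "(\<lambda>n. (\<gamma>2 n / \<eta> n + 1 / \<eta> n) * (\<eta> n / norm (\<sigma>2 n))) \<longlonglongrightarrow> (0 + 0) * norm (1 / \<theta>2)"
    by (intro tendsto_intros \<gamma>_\<eta> inv_\<eta> \<eta>_\<sigma>_norm)
  moreover have "eventually (\<lambda>n. (\<gamma>2 n / \<eta> n + 1 / \<eta> n) * (\<eta> n / norm (\<sigma>2 n))
      = (\<gamma>2 n + 1) / norm (\<sigma>2 n)) sequentially"
    using \<eta>_pos \<sigma>_nonzero by eventually_elim (simp add: field_simps)
  ultimately have "(\<lambda>n. (\<gamma>2 n + 1) / norm (\<sigma>2 n)) \<longlonglongrightarrow> (0 + 0) * norm (1 / \<theta>2)"
    by (rule Lim_transform_eventually)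
  then have \<gamma>_\<sigma>: "(\<lambda>n. (\<gamma>2 n + 1) / norm (\<sigma>2 n)) \<longlonglongrightarrow> 0" by simp

  define G where "G n m k = \<phi> ((partial_sum a k - smul (of_real (\<eta> n) * \<alpha>) 1) ^ m)" for n m k
  have S_moment: "expected_state M \<phi> (S n ^ m) = (1 / \<sigma> n) ^ m * expectation (\<lambda>\<omega>. G n m (N n \<omega>))"
    for n m
    by (simp add: expected_state_def power_fun_apply S smul_power \<phi>_smul G_def)
  have limit: "(\<lambda>n. expected_state M \<phi> (S n ^ m)) \<longlonglongrightarrow> c m" for m
  proof (cases m)
    case 0
    then show ?thesis unfolding S_moment by (simp add: G_def unital prob_space c)
  next
    case (Suc q)
    define L where "L n = r ^ m * c m * of_real (sqrt (\<eta> n)) ^ m" for n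
    \<comment> \<open>No branches of square roots need to be compared: for even \<open>m\<close>
      only the squares of \<open>r\<close> and \<open>\<sigma> n\<close> enter, and for odd
      \<open>m\<close> the coefficient \<open>c m\<close> is 0.\<close>
    have lead: "(\<lambda>n. (1 / \<sigma> n) ^ m * L n) \<longlonglongrightarrow> c m"
    proof (cases "even m")
      case False
      then have "c m = 0"
        using odd_moment_of_linear_recursion[OF sc_rec(2,3)] by (simp add: c_def)
      then show ?thesis by (simp add: L_def)
    next
      case True
      then obtain p where p: "m = 2 * p" by blast
      have "eventually (\<lambda>n. c m * (\<theta>2 * (of_real (\<eta> n) / \<sigma>2 n)) ^ p = (1 / \<sigma> n) ^ m * L n) sequentially"
        using \<eta>_pos
      proof eventually_elim
        case (elim n)
        have "(of_real (sqrt (\<eta> n)))\<^sup>2 = (of_real (\<eta> n) :: complex)"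
          using elim by (simp flip: of_real_power)
        then show ?case
          by (simp add: L_def p power_mult r \<sigma>_sq power_divide power_mult_distrib)
      qed
      moreover have "(\<lambda>n. c m * (\<theta>2 * (of_real (\<eta> n) / \<sigma>2 n)) ^ p) \<longlonglongrightarrow> c m * (\<theta>2 * (1 / \<theta>2)) ^ p"
        by (intro tendsto_intros \<eta>_\<sigma>)
      ultimately have "(\<lambda>n. (1 / \<sigma> n) ^ m * L n) \<longlonglongrightarrow> c m * (\<theta>2 * (1 / \<theta>2)) ^ p"
        by (rule Lim_transform_eventually[rotated])
      then show ?thesis using theta_nonzero by simp
    qed
    obtain C where C: "C \<ge> 0" "\<And>k h. h \<ge> 1 \<Longrightarrow>
        norm (\<phi> ((partial_sum a k - smul (of_real (h\<^sup>2) * \<alpha>) 1) ^ m) - r ^ m * c m * of_real h ^ m)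
          \<le> C * ((\<bar>real k - h\<^sup>2\<bar> + 1) * (\<bar>real k - h\<^sup>2\<bar> + h) ^ q)"
      using centered_sum_moment[OF r c, of m] by (auto simp: Suc)
    obtain K where K: "eventually (\<lambda>n. norm (expectation (\<lambda>\<omega>. \<bar>real (N n \<omega>) - \<eta> n\<bar> ^ (2 * q)))
        \<le> K * norm (norm (\<sigma> n) ^ (2 * q))) sequentially"
      using central_moments[of "2 * q"] by (elim landau_o.bigE)
    \<comment> \<open>\<open>B\<close> is the squared error divided by
      \<open>norm (\<sigma>2 n) ^ m\<close>. With \<open>m = q + 1\<close>, one factor goes to
      \<open>\<gamma>2 n + 1\<close>, which becomes small, and the other \<open>q\<close> factors
      keep the last bracket convergent.\<close>
    define B where "B n = C\<^sup>2 * (4 * ((\<gamma>2 n + 1) / norm (\<sigma>2 n)) * (4 ^ q * (K + (\<eta> n / norm (\<sigma>2 n)) ^ q)))" for n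
    have "eventually (\<lambda>n. norm ((norm (expected_state M \<phi> (S n ^ m) - (1 / \<sigma> n) ^ m * L n))\<^sup>2) \<le> B n) sequentially"
      using \<eta>_pos \<sigma>_nonzero K eventually_ge_at_top[of 1]
    proof eventually_elim
      case (elim n)
      define h where "h = sqrt (\<eta> n)"
      have h: "h \<ge> 1" "h\<^sup>2 = \<eta> n" using elim by (simp_all add: h_def)
      define D where "D = expectation (\<lambda>\<omega>. \<bar>real (N n \<omega>) - \<eta> n\<bar> ^ (2 * q))"
      have \<gamma>: "expectation (\<lambda>\<omega>. \<bar>real (N n \<omega>) - \<eta> n\<bar> ^ 2) = \<gamma>2 n"
        by (simp add: gamma eta)
      have "\<gamma>2 n \<ge> 0" by (simp add: gamma)
      have "(norm (expectation (\<lambda>\<omega>. G n m (N n \<omega>)) - L n))\<^sup>2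
          \<le> C\<^sup>2 * (4 * (\<gamma>2 n + 1) * (4 ^ q * (D + \<eta> n ^ q)))"
        unfolding \<gamma>[symmetric] D_def h(2)[symmetric]
        by (rule expectation_polynomially_close)
          (use random_variable moments_finite C(2)[OF h(1)] C(1) h(1) elim in
            \<open>simp_all add: G_def L_def h(2) flip: h_def\<close>)
      also have "\<dots> \<le> C\<^sup>2 * (4 * (\<gamma>2 n + 1) * (4 ^ q * (K * norm (\<sigma>2 n) ^ q + \<eta> n ^ q)))"
        using elim(3) \<open>\<gamma>2 n \<ge> 0\<close> by (intro mult_left_mono add_right_mono) (auto simp: D_def norm_\<sigma>)
      also have "\<dots> = norm (\<sigma>2 n) ^ m * B n"
        using elim(2) by (simp add: B_def Suc field_simps)
      finally have "(norm (expectation (\<lambda>\<omega>. G n m (N n \<omega>)) - L n))\<^sup>2 \<le> norm (\<sigma>2 n) ^ m * B n" .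
      moreover have "(norm (expected_state M \<phi> (S n ^ m) - (1 / \<sigma> n) ^ m * L n))\<^sup>2
          = (norm (expectation (\<lambda>\<omega>. G n m (N n \<omega>)) - L n))\<^sup>2 / norm (\<sigma>2 n) ^ m"
      proof -
        have "(norm ((1 / \<sigma> n) ^ m))\<^sup>2 = 1 / norm (\<sigma>2 n) ^ m"
          using norm_\<sigma>[of n m] by (simp add: norm_power norm_divide power_divide mult.commute flip: power_mult)
        then show ?thesis
          by (simp add: S_moment power_mult_distrib norm_mult flip: right_diff_distrib)
      qed
      ultimately show ?case
        using elim(2) by (simp add: divide_le_eq mult.commute)
    qed
    moreover have "B \<longlonglongrightarrow> C\<^sup>2 * (4 * 0 * (4 ^ q * (K + norm (1 / \<theta>2) ^ q)))"
      unfolding B_def by (intro tendsto_intros \<gamma>_\<sigma> \<eta>_\<sigma>_norm)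
    then have "B \<longlonglongrightarrow> 0" by simp
    ultimately have "(\<lambda>n. (norm (expected_state M \<phi> (S n ^ m) - (1 / \<sigma> n) ^ m * L n))\<^sup>2) \<longlonglongrightarrow> 0"
      by (rule Lim_null_comparison)
    then have "(\<lambda>n. expected_state M \<phi> (S n ^ m) - (1 / \<sigma> n) ^ m * L n) \<longlonglongrightarrow> 0"
      by (simp add: tendsto_norm_zero_iff)
    from tendsto_add[OF this lead] show ?thesis by simp
  qed

  have "converges_star (\<lambda>_. expected_state M \<phi>) S \<psi> s"
    using limit by (simp add: converges_star_def sc_moments c_def)
  moreover have "weak_conv_m \<mu> \<mu>\<^sub>s"
    if \<mu>: "\<forall>n\<ge>1. is_probability_measure_of (expected_state M \<phi>) (S n) (\<mu> n)" for \<mu>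
  proof -
    \<comment> \<open>The measures are given for \<open>n \<ge> 1\<close> only, so the sequence is
      shifted by one and the limit is transferred back at the end.\<close>
    have \<mu>': "real_distribution (\<mu> (Suc n))" "integrable (\<mu> (Suc n)) (\<lambda>t. t ^ m)"
      "of_real (\<integral>t. t ^ m \<partial>\<mu> (Suc n)) = expected_state M \<phi> (S (Suc n) ^ m)" for n m
      using \<mu> by (simp_all add: is_probability_measure_of_def same_moments_def)
    have "weak_conv_m (\<lambda>n. \<mu> (Suc n)) semicircle"
    proof (rule weak_conv_of_moments[OF \<mu>'(1,2) sc.real_distribution_axioms sc_integrable])
      show "\<bar>\<integral>t. t ^ m \<partial>semicircle\<bar> \<le> 2 ^ m" for m
        using abs_le_of_linear_recursion[OF sc_rec] by (simp add: sc_moment_def)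
      show "(\<lambda>n. \<integral>t. t ^ m \<partial>\<mu> (Suc n)) \<longlonglongrightarrow> (\<integral>t. t ^ m \<partial>semicircle)" for m
        using LIMSEQ_Suc[OF limit[of m]]
        by (simp add: c_def tendsto_of_real_iff flip: \<mu>'(3) sc_moment_def)
    qed
    then show ?thesis
      unfolding mu_s_eq weak_conv_m_def weak_conv_def by (blast intro: LIMSEQ_imp_Suc)
  qed
  ultimately show ?thesis by blast
qed

end
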